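(* Let $\Lambda$ be a $k$-graph. Then the bijections $Q_r(\Lambda)\to\overline{Q}_r(\Lambda)$, $\lambda\mapsto\varphi_\lambda$ ($r\ge0$), induce an isomorphism of complexes $(C_*(\Lambda),\partial_* )\cong(\overline{C}_*(\Lambda),\overline{\partial}_* )$. Hence $\overline{H}_*(\Lambda)\cong H_*(\Lambda)$.
   Context: Conventions: $0\in\mathbb{N}$ and $\mathbb{N}^0=\{0\}$. A $k$-graph ($k\ge0$) is a nonempty countable small category $\Lambda$ with a functor $d:\Lambda\to\mathbb{N}^k$ (the degree) satisfying the factorisation property: whenever $d(\lambda)=m+n$ there are unique $\mu,\nu\in\Lambda$ with $d(\mu)=m$, $d(\nu)=n$, $\lambda=\mu\nu$. $\Lambda^n=d^{-1}(n)$. For $0\le m\le n\le d(\lambda)$, $\lambda(m,n)$ is the unique $\beta\in\Lambda^{n-m}$ with $\lambda=\alpha\beta\gamma$ for some $\alpha\in\Lambda^m$, $\gamma\in\Lambda^{d(\lambda)-n}$. $e_i$ are the standard generators, $\mathbf{1}_r=\sum_{i=1}^re_i\in\mathbb{N}^r$, $\le$ is coordinatewise, $|n|=\sum_i n_i$. A quasimorphism from a $k$-graph $(\Lambda,d)$ to an $l$-graph $(\Gamma,d')$ is a functor $\psi$ for which there is a homomorphism $\pi:\mathbb{N}^k\to\mathbb{N}^l$ with $\pi\circ d=d'\circ\psi$. $Q_r(\Lambda)=\{\lambda\in\Lambda: d(\lambda)\le\mathbf{1}_k,|d(\lambda)|=r\}$. For $\lambda\in Q_r(\Lambda)$ with $d(\lambda)=e_{i_1}+\dots+e_{i_r}$,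 $i_1<\dots<i_r$, and $1\le j\le r$, $F_j^0(\lambda)=\lambda(0,d(\lambda)-e_{i_j})$, $F_j^1(\lambda)=\lambda(e_{i_j},d(\lambda))$. $C_r(\Lambda)=\mathbb{Z}Q_r(\Lambda)$ (free abelian group), $\partial_r(\lambda)=\sum_{\ell=0}^1\sum_{i=1}^r(-1)^{i+\ell}F_i^\ell(\lambda)$ for $r\ge 1$, $\partial_0=0$, and $H_*(\Lambda)$ is the homology of $(C_*(\Lambda),\partial_* )$. $\mathbb{1}_r$ is the $r$-graph $\{(p,q)\in\mathbb{N}^r\times\mathbb{N}^r:p\le q\le\mathbf{1}_r\}$ with $r(p,q)=(p,p)$, $s(p,q)=(q,q)$, $d(p,q)=q-p$, $(p,q)(q,u)=(p,u)$. For $1\le i\le r+1$, $\ell\in\{0,1\}$, $\varepsilon^\ell_i:\mathbb{1}_r\to\mathbb{1}_{r+1}$ is the quasimorphism inserting $\ell$ as the $i$th coordinate in both entries. A homomorphism $h:\mathbb{N}^r\to\mathbb{N}^k$ is admissible of rank $t$ if there are $1\le i_1<\dots<i_t\le r$ and $1\le j_1<\dots<j_t\le k$ with $h(e_{i_p})=e_{j_p}$ for $p\le t$ and $h(e_i)=0$ otherwise. An $r$-cube of rank $t$ is a quasimorphism $\varphi:\mathbb{1}_r\to\Lambda$ with $d_\Lambda\circ\varphi=h\circ d_{\mathbb{1}_r}$ for an admissible $h:\mathbb{N}^r\to\mathbb{N}^k$ of rank $t$; it is nondegenerate if $t=r$. $\overline{Q}_r(\Lambda)$ is the set of nondegenerate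 $r$-cubes, $\overline{\varepsilon}^\ell_i(\varphi)=\varphi\circ\varepsilon^\ell_i$, which maps $\overline{Q}_{r}(\Lambda)$ to $\overline{Q}_{r-1}(\Lambda)$ for $1\le i\le r$. $\overline{C}_r(\Lambda)=\mathbb{Z}\overline{Q}_r(\Lambda)$, $\overline{\partial}_r(\varphi)=\sum_{\ell=0}^1\sum_{i=1}^r(-1)^{i+\ell}\,\overline{\varepsilon}_i^\ell(\varphi)$; this is a chain complex (Grandis' normalised complex of the cubical set of all cubes of $\Lambda$), and $\overline{H}_*(\Lambda)$ is its homology. For $\lambda\in Q_r(\Lambda)$, $\varphi_\lambda\in\overline{Q}_r(\Lambda)$ is the unique nondegenerate $r$-cube with $\varphi_\lambda(0,\mathbf{1}_r)=\lambda$; explicitly, if $d(\lambda)=e_{i_1}+\dots+e_{i_r}$ with $i_1<\dots<i_r$ and $h(e_j)=e_{i_j}$, then $\varphi_\lambda(m,n)=\lambda(h(m),h(n))$. The map $\lambda\mapsto\varphi_\lambda$ is a bijection $Q_r(\Lambda)\to\overline{Q}_r(\Lambda)$. *)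

theory Defs
  imports
    "HOL-Algebra.Free_Abelian_Groups"
    "HOL-Library.FuncSet"
    "HOL-Library.Countable_Set"
    "HOL-Library.Function_Algebras"
begin

section \<open>The monoids of multi-degrees\<close>

text \<open>An element of \<open>\<nat>\<^sup>k\<close> is a function \<open>nat \<Rightarrow> nat\<close> that vanishes outside the coordinates
  \<open>1, \<dots>, k\<close>. Addition, subtraction, zero and the order on functions are pointwise, so \<open>\<le>\<close> is the
  coordinatewise order, and \<open>\<nat>\<^sup>0\<close> consists of \<open>0\<close> only.\<close>

definition Nk :: "nat \<Rightarrow> (nat \<Rightarrow> nat) set" where
  "Nk k = {n. \<forall>i. i \<notin> {1..k} \<longrightarrow> n i = 0}"

definition unit_deg :: "nat \<Rightarrow> nat \<Rightarrow> nat" where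
  "unit_deg i = (\<lambda>j. if j = i then 1 else 0)"

definition ones :: "nat \<Rightarrow> nat \<Rightarrow> nat" where
  "ones r = (\<Sum>i = 1..r. unit_deg i)"

definition deg_size :: "nat \<Rightarrow> (nat \<Rightarrow> nat) \<Rightarrow> nat" where
  "deg_size k n = (\<Sum>i = 1..k. n i)"

definition Nk_hom :: "nat \<Rightarrow> nat \<Rightarrow> ((nat \<Rightarrow> nat) \<Rightarrow> (nat \<Rightarrow> nat)) \<Rightarrow> bool" where
  "Nk_hom r k h \<longleftrightarrow> h \<in> Nk r \<rightarrow> Nk k \<and> h 0 = 0 \<and> (\<forall>m\<in>Nk r. \<forall>n\<in>Nk r. h (m + n) = h m + h n)"

section \<open>Small categories and higher-rank graphs\<close>

text \<open>A small category is given by its set of morphisms; objects are identified with their identity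
  morphisms. \<open>cmp \<Lambda> a b\<close> is the composite written \<open>ab\<close>, which is meaningful when
  the source of \<open>a\<close> is the range of \<open>b\<close>.\<close>

record 'a deg_category =
  Mor :: "'a set"
  rng :: "'a \<Rightarrow> 'a"
  src :: "'a \<Rightarrow> 'a"
  cmp :: "'a \<Rightarrow> 'a \<Rightarrow> 'a"
  dgr :: "'a \<Rightarrow> nat \<Rightarrow> nat"

locale small_category =
  fixes \<Lambda> :: "'a deg_category"
  assumes rng_closed: "a \<in> Mor \<Lambda> \<Longrightarrow> rng \<Lambda> a \<in> Mor \<Lambda>"
    and src_closed: "a \<in> Mor \<Lambda> \<Longrightarrow> src \<Lambda> a \<in> Mor \<Lambda>"
    and rng_rng: "a \<in> Mor \<Lambda> \<Longrightarrow> rng \<Lambda> (rng \<Lambda> a) = rng \<Lambda> a"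
    and src_rng: "a \<in> Mor \<Lambda> \<Longrightarrow> src \<Lambda> (rng \<Lambda> a) = rng \<Lambda> a"
    and rng_src: "a \<in> Mor \<Lambda> \<Longrightarrow> rng \<Lambda> (src \<Lambda> a) = src \<Lambda> a"
    and src_src: "a \<in> Mor \<Lambda> \<Longrightarrow> src \<Lambda> (src \<Lambda> a) = src \<Lambda> a"
    and cmp_closed: "\<lbrakk>a \<in> Mor \<Lambda>; b \<in> Mor \<Lambda>; src \<Lambda> a = rng \<Lambda> b\<rbrakk> \<Longrightarrow> cmp \<Lambda> a b \<in> Mor \<Lambda>"
    and rng_cmp: "\<lbrakk>a \<in> Mor \<Lambda>; b \<in> Mor \<Lambda>; src \<Lambda> a = rng \<Lambda> b\<rbrakk> \<Longrightarrow> rng \<Lambda> (cmp \<Lambda> a b) = rng \<Lambda> a"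
    and src_cmp: "\<lbrakk>a \<in> Mor \<Lambda>; b \<in> Mor \<Lambda>; src \<Lambda> a = rng \<Lambda> b\<rbrakk> \<Longrightarrow> src \<Lambda> (cmp \<Lambda> a b) = src \<Lambda> b"
    and rng_left_unit: "a \<in> Mor \<Lambda> \<Longrightarrow> cmp \<Lambda> (rng \<Lambda> a) a = a"
    and src_right_unit: "a \<in> Mor \<Lambda> \<Longrightarrow> cmp \<Lambda> a (src \<Lambda> a) = a"
    and cmp_assoc: "\<lbrakk>a \<in> Mor \<Lambda>; b \<in> Mor \<Lambda>; c \<in> Mor \<Lambda>; src \<Lambda> a = rng \<Lambda> b; src \<Lambda> b = rng \<Lambda> c\<rbrakk>
      \<Longrightarrow> cmp \<Lambda> (cmp \<Lambda> a b) c = cmp \<Lambda> a (cmp \<Lambda> b c)"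

locale k_graph = small_category \<Lambda> for k :: nat and \<Lambda> :: "'a deg_category" +
  assumes Mor_nonempty: "Mor \<Lambda> \<noteq> {}"
    and Mor_countable: "countable (Mor \<Lambda>)"
    and dgr_in_Nk: "a \<in> Mor \<Lambda> \<Longrightarrow> dgr \<Lambda> a \<in> Nk k"
    and dgr_rng: "a \<in> Mor \<Lambda> \<Longrightarrow> dgr \<Lambda> (rng \<Lambda> a) = 0"
    and dgr_src: "a \<in> Mor \<Lambda> \<Longrightarrow> dgr \<Lambda> (src \<Lambda> a) = 0"
    and dgr_cmp: "\<lbrakk>a \<in> Mor \<Lambda>; b \<in> Mor \<Lambda>; src \<Lambda> a = rng \<Lambda> b\<rbrakk>
      \<Longrightarrow> dgr \<Lambda> (cmp \<Lambda> a b) = dgr \<Lambda> a + dgr \<Lambda> b"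
    and factorisation: "\<lbrakk>a \<in> Mor \<Lambda>; m \<in> Nk k; n \<in> Nk k; dgr \<Lambda> a = m + n\<rbrakk>
      \<Longrightarrow> \<exists>!(\<mu>, \<nu>). \<mu> \<in> Mor \<Lambda> \<and> \<nu> \<in> Mor \<Lambda> \<and> src \<Lambda> \<mu> = rng \<Lambda> \<nu> \<and>
            dgr \<Lambda> \<mu> = m \<and> dgr \<Lambda> \<nu> = n \<and> a = cmp \<Lambda> \<mu> \<nu>"

definition Mor_deg :: "'a deg_category \<Rightarrow> (nat \<Rightarrow> nat) \<Rightarrow> 'a set" where
  "Mor_deg \<Lambda> n = {a \<in> Mor \<Lambda>. dgr \<Lambda> a = n}"

text \<open>The segment \<open>\<lambda>(m, n)\<close>, for \<open>0 \<le> m \<le> n \<le> d(\<lambda>)\<close>.\<close>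

definition segment :: "'a deg_category \<Rightarrow> 'a \<Rightarrow> (nat \<Rightarrow> nat) \<Rightarrow> (nat \<Rightarrow> nat) \<Rightarrow> 'a" where
  "segment \<Lambda> a m n = (THE \<beta>. \<beta> \<in> Mor_deg \<Lambda> (n - m) \<and>
     (\<exists>\<alpha>\<in>Mor_deg \<Lambda> m. \<exists>\<gamma>\<in>Mor_deg \<Lambda> (dgr \<Lambda> a - n).
        src \<Lambda> \<alpha> = rng \<Lambda> \<beta> \<and> src \<Lambda> \<beta> = rng \<Lambda> \<gamma> \<and> a = cmp \<Lambda> \<alpha> (cmp \<Lambda> \<beta> \<gamma>)))"

definition is_functor :: "'a deg_category \<Rightarrow> 'b deg_category \<Rightarrow> ('a \<Rightarrow> 'b) \<Rightarrow> bool" where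
  "is_functor \<Lambda> \<Gamma> \<psi> \<longleftrightarrow> \<psi> \<in> Mor \<Lambda> \<rightarrow> Mor \<Gamma> \<and>
     (\<forall>a\<in>Mor \<Lambda>. \<psi> (rng \<Lambda> a) = rng \<Gamma> (\<psi> a) \<and> \<psi> (src \<Lambda> a) = src \<Gamma> (\<psi> a)) \<and>
     (\<forall>a\<in>Mor \<Lambda>. \<forall>b\<in>Mor \<Lambda>. src \<Lambda> a = rng \<Lambda> b \<longrightarrow> \<psi> (cmp \<Lambda> a b) = cmp \<Gamma> (\<psi> a) (\<psi> b))"

definition quasimorphism ::
  "nat \<Rightarrow> 'a deg_category \<Rightarrow> nat \<Rightarrow> 'b deg_category \<Rightarrow> ('a \<Rightarrow> 'b) \<Rightarrow> bool" where
  "quasimorphism k \<Lambda> l \<Gamma> \<psi> \<longleftrightarrow> is_functor \<Lambda> \<Gamma> \<psi> \<and>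
     (\<exists>\<pi>. Nk_hom k l \<pi> \<and> (\<forall>a\<in>Mor \<Lambda>. \<pi> (dgr \<Lambda> a) = dgr \<Gamma> (\<psi> a)))"

section \<open>Chain complexes of abelian groups and their homology\<close>

text \<open>A complex consists of groups \<open>C r\<close> and differentials \<open>D r : C r \<rightarrow> C (r - 1)\<close>, \<open>r \<ge> 0\<close>. With
  truncated subtraction \<open>D 0\<close> formally maps \<open>C 0\<close> to itself; it is required to be trivial, so that
  its kernel is all of \<open>C 0\<close>.\<close>

definition chain_complex :: "(nat \<Rightarrow> 'c monoid) \<Rightarrow> (nat \<Rightarrow> 'c \<Rightarrow> 'c) \<Rightarrow> bool" where
  "chain_complex C D \<longleftrightarrow> (\<forall>r. comm_group (C r)) \<and> (\<forall>r. D r \<in> hom (C r) (C (r - 1))) \<and>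
     (\<forall>c\<in>carrier (C 0). D 0 c = \<one>\<^bsub>C 0\<^esub>) \<and>
     (\<forall>r. \<forall>c\<in>carrier (C (Suc r)). D r (D (Suc r) c) = \<one>\<^bsub>C (r - 1)\<^esub>)"

definition complex_iso :: "(nat \<Rightarrow> 'c monoid) \<Rightarrow> (nat \<Rightarrow> 'c \<Rightarrow> 'c) \<Rightarrow>
    (nat \<Rightarrow> 'd monoid) \<Rightarrow> (nat \<Rightarrow> 'd \<Rightarrow> 'd) \<Rightarrow> (nat \<Rightarrow> 'c \<Rightarrow> 'd) \<Rightarrow> bool" where
  "complex_iso C D C' D' f \<longleftrightarrow> chain_complex C D \<and> chain_complex C' D' \<and>
     (\<forall>r. f r \<in> iso (C r) (C' r)) \<and>
     (\<forall>r. \<forall>c\<in>carrier (C r). f (r - 1) (D r c) = D' r (f r c))"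

definition homology :: "(nat \<Rightarrow> 'c monoid) \<Rightarrow> (nat \<Rightarrow> 'c \<Rightarrow> 'c) \<Rightarrow> nat \<Rightarrow> 'c set monoid" where
  "homology C D r = ((C r)\<lparr>carrier := kernel (C r) (C (r - 1)) (D r)\<rparr>)
                      Mod (D (Suc r) ` carrier (C (Suc r)))"

section \<open>The complex of a higher-rank graph\<close>

definition graph_cubes :: "nat \<Rightarrow> 'a deg_category \<Rightarrow> nat \<Rightarrow> 'a set" where
  "graph_cubes k \<Lambda> r = {a \<in> Mor \<Lambda>. dgr \<Lambda> a \<le> ones k \<and> deg_size k (dgr \<Lambda> a) = r}"

text \<open>If \<open>n\<close> is a sum of distinct unit vectors, with directions \<open>i\<^sub>1 < \<dots> < i\<^sub>r\<close>, then
  \<open>direction n j = i\<^sub>j\<close> for \<open>1 \<le> j \<le> r\<close>; hence the shift of the list index.\<close>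

definition direction :: "(nat \<Rightarrow> nat) \<Rightarrow> nat \<Rightarrow> nat" where
  "direction n j = sorted_list_of_set {i. n i \<noteq> 0} ! (j - 1)"

definition graph_face :: "'a deg_category \<Rightarrow> nat \<Rightarrow> nat \<Rightarrow> 'a \<Rightarrow> 'a" where
  "graph_face \<Lambda> l j a = (if l = 0 then segment \<Lambda> a 0 (dgr \<Lambda> a - unit_deg (direction (dgr \<Lambda> a) j))
                else segment \<Lambda> a (unit_deg (direction (dgr \<Lambda> a) j)) (dgr \<Lambda> a))"

definition graph_chains :: "nat \<Rightarrow> 'a deg_category \<Rightarrow> nat \<Rightarrow> ('a \<Rightarrow>\<^sub>0 int) monoid" where
  "graph_chains k \<Lambda> r = free_Abelian_group (graph_cubes k \<Lambda> r)"

text \<open>For \<open>r = 0\<close> the inner sum is empty, so \<open>\<partial>\<^sub>0 = 0\<close>.\<close>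

definition graph_boundary :: "'a deg_category \<Rightarrow> nat \<Rightarrow> ('a \<Rightarrow>\<^sub>0 int) \<Rightarrow> ('a \<Rightarrow>\<^sub>0 int)" where
  "graph_boundary \<Lambda> r = frag_extend
     (\<lambda>a. \<Sum>l = 0..1. \<Sum>i = 1..r. frag_cmul ((-1) ^ (i + l)) (frag_of (graph_face \<Lambda> l i a)))"

definition graph_homology :: "nat \<Rightarrow> 'a deg_category \<Rightarrow> nat \<Rightarrow> ('a \<Rightarrow>\<^sub>0 int) set monoid" where
  "graph_homology k \<Lambda> = homology (graph_chains k \<Lambda>) (graph_boundary \<Lambda>)"

section \<open>The normalised complex of the cubical set of a higher-rank graph\<close>

type_synonym cell = "(nat \<Rightarrow> nat) \<times> (nat \<Rightarrow> nat)"

definition std_cube :: "nat \<Rightarrow> cell deg_category" where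
  "std_cube r = \<lparr>Mor = {(p, q). p \<in> Nk r \<and> q \<in> Nk r \<and> p \<le> q \<and> q \<le> ones r},
     rng = (\<lambda>(p, q). (p, p)), src = (\<lambda>(p, q). (q, q)),
     cmp = (\<lambda>(p, q) (q', u). (p, u)), dgr = (\<lambda>(p, q). q - p)\<rparr>"

definition ins :: "nat \<Rightarrow> nat \<Rightarrow> (nat \<Rightarrow> nat) \<Rightarrow> (nat \<Rightarrow> nat)" where
  "ins i l n = (\<lambda>j. if j < i then n j else if j = i then l else n (j - 1))"

definition eps :: "nat \<Rightarrow> nat \<Rightarrow> cell \<Rightarrow> cell" where
  "eps l i = (\<lambda>(p, q). (ins i l p, ins i l q))"

definition admissible :: "nat \<Rightarrow> nat \<Rightarrow> nat \<Rightarrow> ((nat \<Rightarrow> nat) \<Rightarrow> (nat \<Rightarrow> nat)) \<Rightarrow> bool" where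
  "admissible r k t h \<longleftrightarrow> Nk_hom r k h \<and>
     (\<exists>i j. strict_mono_on {1..t} i \<and> i ` {1..t} \<subseteq> {1..r} \<and>
            strict_mono_on {1..t} j \<and> j ` {1..t} \<subseteq> {1..k} \<and>
            (\<forall>p\<in>{1..t}. h (unit_deg (i p)) = unit_deg (j p)) \<and>
            (\<forall>q\<in>{1..r} - i ` {1..t}. h (unit_deg q) = 0))"

text \<open>Cubes are maps with domain \<open>Mor (std_cube r)\<close>; extensionality makes two cubes equal precisely
  when they agree on that domain.\<close>

definition cubes :: "nat \<Rightarrow> 'a deg_category \<Rightarrow> nat \<Rightarrow> nat \<Rightarrow> (cell \<Rightarrow> 'a) set" where
  "cubes k \<Lambda> r t = {\<phi> \<in> extensional (Mor (std_cube r)). quasimorphism r (std_cube r) k \<Lambda> \<phi> \<and>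
     (\<exists>h. admissible r k t h \<and>
          (\<forall>x\<in>Mor (std_cube r). dgr \<Lambda> (\<phi> x) = h (dgr (std_cube r) x)))}"

definition nondeg_cubes :: "nat \<Rightarrow> 'a deg_category \<Rightarrow> nat \<Rightarrow> (cell \<Rightarrow> 'a) set" where
  "nondeg_cubes k \<Lambda> r = cubes k \<Lambda> r r"

text \<open>The face of an \<open>r\<close>-cube, \<open>r \<ge> 1\<close>: precomposition with \<open>\<epsilon>\<^sup>l\<^sub>i\<close> from the standard
  \<open>(r - 1)\<close>-cube to the standard \<open>r\<close>-cube.\<close>

definition cube_face :: "nat \<Rightarrow> nat \<Rightarrow> nat \<Rightarrow> (cell \<Rightarrow> 'a) \<Rightarrow> (cell \<Rightarrow> 'a)" where
  "cube_face r l i \<phi> = restrict (\<phi> \<circ> eps l i) (Mor (std_cube (r - 1)))"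

definition cube_chains :: "nat \<Rightarrow> 'a deg_category \<Rightarrow> nat \<Rightarrow> ((cell \<Rightarrow> 'a) \<Rightarrow>\<^sub>0 int) monoid" where
  "cube_chains k \<Lambda> r = free_Abelian_group (nondeg_cubes k \<Lambda> r)"

definition cube_boundary :: "nat \<Rightarrow> ((cell \<Rightarrow> 'a) \<Rightarrow>\<^sub>0 int) \<Rightarrow> ((cell \<Rightarrow> 'a) \<Rightarrow>\<^sub>0 int)" where
  "cube_boundary r = frag_extend
     (\<lambda>\<phi>. \<Sum>l = 0..1. \<Sum>i = 1..r. frag_cmul ((-1) ^ (i + l)) (frag_of (cube_face r l i \<phi>)))"

definition cube_homology :: "nat \<Rightarrow> 'a deg_category \<Rightarrow> nat \<Rightarrow> ((cell \<Rightarrow> 'a) \<Rightarrow>\<^sub>0 int) set monoid" where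
  "cube_homology k \<Lambda> = homology (cube_chains k \<Lambda>) cube_boundary"

definition cube_of :: "nat \<Rightarrow> 'a deg_category \<Rightarrow> nat \<Rightarrow> 'a \<Rightarrow> (cell \<Rightarrow> 'a)" where
  "cube_of k \<Lambda> r a = (THE \<phi>. \<phi> \<in> nondeg_cubes k \<Lambda> r \<and> \<phi> (0, ones r) = a)"

end

theory Submission
  imports Defs
begin

text \<open>A nondegenerate \<open>r\<close>-cube is the same thing as a path of degree
  \<open>e\<^bsub>i1\<^esub> + \<dots> + e\<^bsub>ir\<^esub>\<close>, cut up in every possible way. A strictly increasing self-map of
  \<open>{1..r}\<close> is the identity, so an admissible homomorphism \<open>h\<close> of full rank only relabels the
  coordinates along an increasing map \<open>j\<close> (\<open>nondeg_cubes_iff\<close>). Applying a cube \<open>\<phi>\<close> to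
  \<open>(0, \<one>) = (0, m)(m, n)(n, \<one>)\<close> displays \<open>\<phi>(m, n)\<close> as a middle factor, with degrees prescribed by
  \<open>h\<close>, of \<open>a = \<phi>(0, \<one>)\<close>; unique factorisation gives \<open>\<phi>(m, n) = a(h m, h n)\<close>, and \<open>j\<close> is read off the
  degree of \<open>a\<close> (\<open>nondeg_cube_is_path_cube\<close>). Conversely the segments of a path compose like the
  cells of the standard cube (\<open>segment_cmp\<close>), so this formula defines a cube
  (\<open>path_cube_nondeg\<close>).

  Compatibility with faces needs no calculation with segments of segments. A face of a
  nondegenerate cube is again a nondegenerate cube (\<open>cube_face_nondeg\<close>), hence determined by its
  value at \<open>(0, \<one>)\<close>, and this value is the face of \<open>a\<close> (\<open>path_cube_face\<close>). So the bijections commute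
  with the boundaries. That \<open>\<partial>\<partial> = 0\<close> follows for cubes from the cubical identity and a
  sign-reversing pairing (\<open>cubical_boundary_square\<close>), and passes to the complex of the graph
  because the comparison maps are injective. Finally an isomorphism of complexes matches kernels
  with kernels and images with images, hence induces isomorphisms of the homology groups
  (\<open>homology_complex_iso\<close>).\<close>

section \<open>Multi-degrees\<close>

(* The coordinates are counted from 1; rewriting 1 to Suc 0 would obscure the intervals {1..r}. *)
declare One_nat_def [simp del]

lemma ones_apply: "ones r i = (if i \<in> {1..r} then 1 else 0)"
proof (induction r)
  case 0
  show ?case by (simp add: ones_def)
next
  case (Suc r)
  have "ones (Suc r) = ones r + unit_deg (Suc r)"
    by (simp add: ones_def)
  with Suc show ?case by (auto simp: unit_deg_def)
qed

lemma le_Nk: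
  assumes "m \<le> n" "n \<in> Nk k" shows "m \<in> Nk k"
  unfolding Nk_def
proof safe
  fix i assume "i \<notin> {1..k}"
  with assms(2) have "n i = 0" by (auto simp: Nk_def)
  with le_funD [OF assms(1), of i] show "m i = 0" by simp
qed

lemma ones_in_Nk: "ones r \<in> Nk r"
  by (auto simp: Nk_def ones_apply)

lemma unit_deg_in_Nk: "unit_deg i \<in> Nk r \<longleftrightarrow> i \<in> {1..r}"
  by (auto simp: Nk_def unit_deg_def)

lemma add_diff_deg:
  fixes m n :: "nat \<Rightarrow> nat"
  shows "m \<le> n \<Longrightarrow> m + (n - m) = n"
  by (auto simp: le_fun_def fun_eq_iff)

text \<open>The additive map \<open>\<nat>\<^sup>r \<rightarrow> \<nat>\<^sup>k\<close> that sends the generator \<open>e\<^sub>p\<close> to the generator with index \<open>j p\<close>.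
  In contrast to an arbitrary \<open>h\<close> with \<open>Nk_hom r k h\<close>, whose values off \<open>Nk r\<close> are arbitrary, it is additive
  and monotone on all functions, so that most of its rules have no side conditions.\<close>

definition relabel :: "(nat \<Rightarrow> nat) \<Rightarrow> nat \<Rightarrow> (nat \<Rightarrow> nat) \<Rightarrow> nat \<Rightarrow> nat" where
  "relabel j r n = (\<lambda>i. \<Sum>p = 1..r. n p * unit_deg (j p) i)"

lemma relabel_zero [simp]: "relabel j r 0 = 0"
  by (auto simp: relabel_def)

lemma relabel_add: "relabel j r (m + n) = relabel j r m + relabel j r n"
  by (auto simp: relabel_def fun_eq_iff sum.distrib distrib_right)

lemma relabel_mono: "m \<le> n \<Longrightarrow> relabel j r m \<le> relabel j r n"
  by (auto simp: relabel_def le_fun_def intro!: sum_mono mult_right_mono)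

lemma relabel_diff:
  assumes "m \<le> n" shows "relabel j r (n - m) = relabel j r n - relabel j r m"
proof -
  have "relabel j r n = relabel j r m + relabel j r (n - m)"
    using assms by (simp add: add_diff_deg flip: relabel_add)
  then show ?thesis by (auto simp: fun_eq_iff)
qed

lemma relabel_in_Nk: "j ` {1..r} \<subseteq> {1..k} \<Longrightarrow> relabel j r n \<in> Nk k"
  by (fastforce simp: Nk_def relabel_def unit_deg_def)

lemma relabel_unit_deg: "p \<in> {1..r} \<Longrightarrow> relabel j r (unit_deg p) = unit_deg (j p)"
proof
  fix i assume "p \<in> {1..r}"
  have "relabel j r (unit_deg p) i = (\<Sum>q = 1..r. if q = p then unit_deg (j p) i else 0)"
    unfolding relabel_def by (rule sum.cong) (auto simp: unit_deg_def)
  with \<open>p \<in> {1..r}\<close> show "relabel j r (unit_deg p) i = unit_deg (j p) i" by simp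
qed

lemma relabel_ones:
  assumes "inj_on j {1..r}"
  shows "relabel j r (ones r) i = (if i \<in> j ` {1..r} then 1 else 0)"
proof -
  have eq: "relabel j r (ones r) i = (\<Sum>p = 1..r. if j p = i then 1 else 0)"
    unfolding relabel_def by (rule sum.cong) (auto simp: ones_apply unit_deg_def)
  show ?thesis
  proof (cases "i \<in> j ` {1..r}")
    case True
    then obtain p where p: "p \<in> {1..r}" "j p = i" by blast
    have "relabel j r (ones r) i = (\<Sum>q = 1..r. if q = p then 1 else 0)"
      unfolding eq using inj_on_eq_iff [OF assms _ p(1)] p(2) by (intro sum.cong) auto
    with True p(1) show ?thesis by simp
  next
    case False
    then show ?thesis unfolding eq by (auto intro!: sum.neutral)
  qed
qed

lemma Nk_hom_relabel: "j ` {1..r} \<subseteq> {1..k} \<Longrightarrow> Nk_hom r k (relabel j r)"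
  using relabel_in_Nk by (auto simp: Nk_hom_def relabel_add)

text \<open>The generators generate \<open>\<nat>\<^sup>r\<close>: induction on the size of \<open>n\<close>, splitting off one generator at a
  time.\<close>

lemma Nk_hom_eq_relabel:
  assumes h: "Nk_hom r k h" and unit: "\<And>p. p \<in> {1..r} \<Longrightarrow> h (unit_deg p) = unit_deg (j p)"
    and n: "n \<in> Nk r"
  shows "h n = relabel j r n"
  using n
proof (induction "\<Sum>p = 1..r. n p" arbitrary: n rule: less_induct)
  case less
  show ?case
  proof (cases "n = 0")
    case True
    with h show ?thesis by (simp add: Nk_hom_def)
  next
    case False
    then obtain p where "n p \<noteq> 0" by (auto simp: fun_eq_iff)
    with less.prems have p: "p \<in> {1..r}" by (auto simp: Nk_def)
    define n' where "n' = n - unit_deg p"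
    have le: "unit_deg p \<le> n" using \<open>n p \<noteq> 0\<close> by (auto simp: le_fun_def unit_deg_def)
    have n': "n' \<in> Nk r" using less.prems by (auto simp: n'_def Nk_def)
    have "(\<Sum>q = 1..r. n' q) < (\<Sum>q = 1..r. n q)"
      using p \<open>n p \<noteq> 0\<close> by (intro sum_strict_mono_ex1) (auto simp: n'_def unit_deg_def)
    with less.hyps n' have "h n' = relabel j r n'" by blast
    moreover have "n = unit_deg p + n'" using le by (simp add: n'_def add_diff_deg)
    moreover have "unit_deg p \<in> Nk r" using p by (simp add: unit_deg_in_Nk)
    ultimately show ?thesis
      using h n' p by (simp add: Nk_hom_def relabel_add relabel_unit_deg unit)
  qed
qed

lemma nth_sorted_list_of_image:
  assumes j: "strict_mono_on {1..r} j" and p: "p \<in> {1..r}"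
  shows "sorted_list_of_set (j ` {1..r}) ! (p - 1) = (j p :: nat)"
proof -
  let ?L = "map j [1..<Suc r]"
  have "sorted_wrt (<) ?L"
    using j by (auto simp: sorted_wrt_iff_nth_less strict_mono_on_def simp del: upt_Suc)
  then have "sorted_list_of_set (set ?L) = ?L"
    unfolding strict_sorted_iff by (intro sorted_list_of_set.idem_if_sorted_distinct) auto
  moreover have "set ?L = j ` {1..r}"
    by (simp only: set_map set_upt atLeastLessThanSuc_atLeastAtMost)
  moreover have "?L ! (p - 1) = j p"
    using p by (subst nth_map) (auto simp del: upt_Suc)
  ultimately show ?thesis by simp
qed

text \<open>Hence an admissible homomorphism of rank \<open>r\<close> on \<open>\<nat>\<^sup>r\<close> sends the generator \<open>e\<^sub>p\<close> to
  \<open>e\<^bsub>j p\<^esub>\<close> for every \<open>p\<close>.\<close>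

lemma strict_mono_self_map:
  assumes i: "strict_mono_on {1..r} i" "i ` {1..r} \<subseteq> {1..r}" and p: "p \<in> {1..r}"
  shows "i p = (p :: nat)"
proof -
  have "i ` {1..r} = {1..r}"
    using i by (intro endo_inj_surj) (auto intro: strict_mono_on_imp_inj_on)
  with nth_sorted_list_of_image [OF i(1) p] nth_sorted_list_of_image [of r "\<lambda>x. x", OF _ p]
  show ?thesis by (simp add: strict_mono_on_def)
qed

text \<open>The degree of the path at the top of a cube remembers the relabelling, so a cube can be
  recovered from that path alone.\<close>

lemma direction_relabel:
  assumes "strict_mono_on {1..r} j" "p \<in> {1..r}"
  shows "direction (relabel j r (ones r)) p = j p"
proof -
  have "{i. relabel j r (ones r) i \<noteq> 0} = j ` {1..r}"
    using assms by (auto simp: relabel_ones strict_mono_on_imp_inj_on)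
  with assms show ?thesis by (simp add: direction_def nth_sorted_list_of_image)
qed

lemma relabel_cong: "(\<And>p. p \<in> {1..r} \<Longrightarrow> j p = j' p) \<Longrightarrow> relabel j r = relabel j' r"
  by (intro ext) (simp add: relabel_def)

text \<open>The inequality \<open>n \<le> \<one>\<close> makes \<open>n\<close> the indicator of its support, whose \<open>r\<close> elements
  \<open>direction n\<close> enumerates in increasing order.\<close>

lemma relabel_direction:
  assumes n: "n \<le> ones k" and r: "deg_size k n = r"
  shows "strict_mono_on {1..r} (direction n)" "direction n ` {1..r} \<subseteq> {1..k}"
    "relabel (direction n) r (ones r) = n"
proof -
  let ?S = "{i. n i \<noteq> 0}"
  have val: "n i \<le> (if i \<in> {1..k} then 1 else 0)" for i
    using le_funD [OF n, of i] by (simp only: ones_apply)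
  have S: "?S \<subseteq> {1..k}"
  proof
    fix i assume "i \<in> ?S" with val [of i] show "i \<in> {1..k}" by (auto split: if_splits)
  qed
  then have fin: "finite ?S" by (rule finite_subset) simp
  have nS: "n i = (if i \<in> ?S then 1 else 0)" for i
    using val [of i] by (auto split: if_splits)
  have "(\<Sum>i = 1..k. n i) = (\<Sum>i\<in>?S. n i)"
    using S by (intro sum.mono_neutral_right) auto
  also have "\<dots> = card ?S"
    unfolding card_eq_sum by (intro sum.cong refl) (metis nS)
  finally have card: "card ?S = r" using r by (simp add: deg_size_def)
  let ?L = "sorted_list_of_set ?S"
  have len: "length ?L = r" using card by simp
  show mono: "strict_mono_on {1..r} (direction n)"
    using len strict_sorted_list_of_set [of ?S]
    by (auto simp: direction_def strict_mono_on_def sorted_wrt_iff_nth_less)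
  have "direction n ` {1..r} = (\<lambda>p. ?L ! p) ` {0..<r}"
  proof -
    have "(\<lambda>p. p - 1) ` {1..r} = {0..<r}"
      by (auto simp: image_iff intro!: bexI [of _ "Suc _"])
    then have "(\<lambda>p. ?L ! p) ` {0..<r} = (\<lambda>p. ?L ! p) ` (\<lambda>p. p - 1) ` {1..r}" by simp
    then show ?thesis by (simp add: image_image direction_def)
  qed
  also have "\<dots> = ?S"
    using fin len by (metis list.set_map map_nth set_sorted_list_of_set set_upt)
  finally have im: "direction n ` {1..r} = ?S" .
  with S show "direction n ` {1..r} \<subseteq> {1..k}" by simp
  show "relabel (direction n) r (ones r) = n"
    unfolding relabel_ones [OF strict_mono_on_imp_inj_on [OF mono], abs_def] im
    by (rule ext) (rule nS [symmetric])
qed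

lemma relabel_ones_cube:
  assumes j: "strict_mono_on {1..r} j" "j ` {1..r} \<subseteq> {1..k}"
  shows "relabel j r (ones r) \<le> ones k" "deg_size k (relabel j r (ones r)) = r"
proof -
  have inj: "inj_on j {1..r}" using j by (simp add: strict_mono_on_imp_inj_on)
  show "relabel j r (ones r) \<le> ones k"
    using j(2) by (auto simp: le_fun_def relabel_ones [OF inj] ones_apply)
  have "deg_size k (relabel j r (ones r)) = (\<Sum>i\<in>{1..k} \<inter> j ` {1..r}. 1)"
    unfolding deg_size_def relabel_ones [OF inj] by (simp add: sum.If_cases Int_def)
  also have "{1..k} \<inter> j ` {1..r} = j ` {1..r}" using j(2) by auto
  finally show "deg_size k (relabel j r (ones r)) = r" by (simp add: card_image inj)
qed

subsection \<open>Inserting a coordinate\<close>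

text \<open>The coordinate of the larger cube that coordinate \<open>p\<close> becomes when a new coordinate is
  inserted at position \<open>i\<close>.\<close>

definition skip :: "nat \<Rightarrow> nat \<Rightarrow> nat" where
  "skip i p = (if p < i then p else Suc p)"

lemma skip_image: "i \<in> {1..Suc r} \<Longrightarrow> skip i ` {1..r} = {1..Suc r} - {i}"
proof (intro equalityI subsetI)
  fix q assume i: "i \<in> {1..Suc r}" and q: "q \<in> {1..Suc r} - {i}"
  show "q \<in> skip i ` {1..r}"
  proof (cases "q < i")
    case True
    with i q show ?thesis by (intro image_eqI [of _ _ q]) (auto simp: skip_def)
  next
    case False
    with i q show ?thesis by (intro image_eqI [of _ _ "q - 1"]) (auto simp: skip_def)
  qed
qed (auto simp: skip_def split: if_splits)

lemma strict_mono_skip: "strict_mono (skip i)"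
  by (auto simp: strict_mono_def skip_def)

lemma relabel_ins:
  assumes i: "i \<in> {1..Suc r}"
  shows "relabel j (Suc r) (ins i l n) = relabel (j \<circ> skip i) r n + (\<lambda>q. l * unit_deg (j i) q)"
proof
  fix q
  let ?t = "\<lambda>p. ins i l n p * unit_deg (j p) q"
  have "(\<Sum>p = 1..Suc r. ?t p) = ?t i + (\<Sum>p\<in>{1..Suc r} - {i}. ?t p)"
    using i by (intro sum.remove) auto
  also have "(\<Sum>p\<in>{1..Suc r} - {i}. ?t p) = (\<Sum>p = 1..r. ?t (skip i p))"
    unfolding skip_image [OF i, symmetric]
    by (subst sum.reindex) (auto intro: inj_on_subset [OF strict_mono_imp_inj_on [OF strict_mono_skip]])
  also have "\<dots> = (\<Sum>p = 1..r. n p * unit_deg (j (skip i p)) q)"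
    by (rule sum.cong) (auto simp: ins_def skip_def)
  finally show "relabel j (Suc r) (ins i l n) q
      = (relabel (j \<circ> skip i) r n + (\<lambda>q. l * unit_deg (j i) q)) q"
    by (simp add: relabel_def ins_def)
qed

lemma ins_le_iff: "ins i l m \<le> ins i l n \<longleftrightarrow> m \<le> n"
proof
  assume le: "ins i l m \<le> ins i l n"
  show "m \<le> n"
  proof (rule le_funI)
    fix p show "m p \<le> n p"
      using le_funD [OF le, of "skip i p"] by (auto simp: ins_def skip_def split: if_splits)
  qed
qed (auto simp: le_fun_def ins_def)

lemma ins_le_ones:
  assumes "i \<in> {1..Suc r}" "l \<le> 1" "n \<le> ones r"
  shows "ins i l n \<le> ones (Suc r)"
proof (rule le_funI)
  fix p
  show "ins i l n p \<le> ones (Suc r) p"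
    using assms(1,2) le_funD [OF assms(3), of p] le_funD [OF assms(3), of "p - 1"]
    by (auto simp: ins_def ones_apply split: if_splits)
qed

lemma ins_diff: "ins i l n - ins i l m = ins i 0 (n - m)"
  by (rule ext) (simp add: ins_def)

text \<open>The source of the cubical identity for faces: position \<open>j\<close> was \<open>j - 1\<close> before the insertion
  at the earlier position \<open>i\<close>.\<close>

lemma ins_ins: "i < j \<Longrightarrow> ins j m (ins i l n) = ins i l (ins (j - 1) m n)"
proof
  fix p assume "i < j"
  then consider "p < i" | "p = i" | "i < p" "p < j" | "p = j" | "j < p" by linarith
  then show "ins j m (ins i l n) p = ins i l (ins (j - 1) m n) p"
    by cases (use \<open>i < j\<close> in \<open>auto simp: ins_def\<close>)
qed

section \<open>Segments of a path\<close>

context k_graph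
begin

lemma factor_unique:
  assumes "\<mu> \<in> Mor \<Lambda>" "\<nu> \<in> Mor \<Lambda>" "src \<Lambda> \<mu> = rng \<Lambda> \<nu>"
    and "\<mu>' \<in> Mor \<Lambda>" "\<nu>' \<in> Mor \<Lambda>" "src \<Lambda> \<mu>' = rng \<Lambda> \<nu>'"
    and deg: "dgr \<Lambda> \<mu> = dgr \<Lambda> \<mu>'" and eq: "cmp \<Lambda> \<mu> \<nu> = cmp \<Lambda> \<mu>' \<nu>'"
  shows "\<mu> = \<mu>'" "\<nu> = \<nu>'"
proof -
  have "dgr \<Lambda> (cmp \<Lambda> \<mu> \<nu>) = dgr \<Lambda> \<mu> + dgr \<Lambda> \<nu>" "dgr \<Lambda> (cmp \<Lambda> \<mu>' \<nu>') = dgr \<Lambda> \<mu>' + dgr \<Lambda> \<nu>'"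
    using assms(1-6) by (simp_all add: dgr_cmp)
  with deg eq have "dgr \<Lambda> \<nu> = dgr \<Lambda> \<nu>'" by simp
  moreover have "\<exists>!(x, y). x \<in> Mor \<Lambda> \<and> y \<in> Mor \<Lambda> \<and> src \<Lambda> x = rng \<Lambda> y \<and> dgr \<Lambda> x = dgr \<Lambda> \<mu> \<and>
      dgr \<Lambda> y = dgr \<Lambda> \<nu> \<and> cmp \<Lambda> \<mu> \<nu> = cmp \<Lambda> x y"
    using assms by (intro factorisation cmp_closed dgr_in_Nk dgr_cmp) auto
  moreover have "x = y" if "\<exists>!z. P z" "P x" "P y" for P and x y :: "'a \<times> 'a"
    using that by blast
  ultimately have "(\<mu>, \<nu>) = (\<mu>', \<nu>')"
    using assms by (smt (verit) case_prodI)
  then show "\<mu> = \<mu>'" "\<nu> = \<nu>'" by auto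
qed

lemma factor_exists:
  assumes "a \<in> Mor \<Lambda>" "m \<le> dgr \<Lambda> a"
  obtains \<mu> \<nu> where "\<mu> \<in> Mor \<Lambda>" "\<nu> \<in> Mor \<Lambda>" "src \<Lambda> \<mu> = rng \<Lambda> \<nu>"
    "dgr \<Lambda> \<mu> = m" "dgr \<Lambda> \<nu> = dgr \<Lambda> a - m" "a = cmp \<Lambda> \<mu> \<nu>"
proof -
  have "dgr \<Lambda> a - m \<le> dgr \<Lambda> a" by (simp add: le_fun_def)
  then have "m \<in> Nk k" "dgr \<Lambda> a - m \<in> Nk k" "dgr \<Lambda> a = m + (dgr \<Lambda> a - m)"
    using assms dgr_in_Nk le_Nk by (auto simp: add_diff_deg)
  from factorisation [OF assms(1) this] that show ?thesis by (elim ex1E) auto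
qed

text \<open>Both \<open>r(a) a\<close> and \<open>a s(a)\<close> factor \<open>a\<close> with degrees \<open>0 + 0\<close>, so they are the same factorisation.\<close>

lemma degree_zero_identity:
  assumes a: "a \<in> Mor \<Lambda>" and deg: "dgr \<Lambda> a = 0"
  shows "rng \<Lambda> a = a" "src \<Lambda> a = a"
proof -
  have eq: "cmp \<Lambda> (rng \<Lambda> a) a = cmp \<Lambda> a (src \<Lambda> a)"
    using a by (simp add: rng_left_unit src_right_unit)
  show "rng \<Lambda> a = a"
    by (rule factor_unique(1) [OF _ _ _ _ _ _ _ eq])
      (use a deg in \<open>simp_all add: rng_closed src_closed src_rng rng_src dgr_rng\<close>)
  have "a = src \<Lambda> a"
    by (rule factor_unique(2) [OF _ _ _ _ _ _ _ eq])
      (use a deg in \<open>simp_all add: rng_closed src_closed src_rng rng_src dgr_rng\<close>)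
  then show "src \<Lambda> a = a" by (rule sym)
qed

text \<open>The middle factor of a threefold factorisation is determined by the degrees: two
  applications of unique factorisation cancel \<open>\<alpha>\<close> and then \<open>\<gamma>\<close>.\<close>

lemma segment_eqI:
  assumes mor: "\<alpha> \<in> Mor \<Lambda>" "\<beta> \<in> Mor \<Lambda>" "\<gamma> \<in> Mor \<Lambda>"
    and comp: "src \<Lambda> \<alpha> = rng \<Lambda> \<beta>" "src \<Lambda> \<beta> = rng \<Lambda> \<gamma>"
    and a: "a = cmp \<Lambda> \<alpha> (cmp \<Lambda> \<beta> \<gamma>)" and m: "m = dgr \<Lambda> \<alpha>" and n: "n = dgr \<Lambda> \<alpha> + dgr \<Lambda> \<beta>"
  shows "segment \<Lambda> a m n = \<beta>"
  unfolding segment_def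
proof (rule the_equality)
  have "dgr \<Lambda> a = dgr \<Lambda> \<alpha> + (dgr \<Lambda> \<beta> + dgr \<Lambda> \<gamma>)"
    using mor comp by (simp add: a dgr_cmp cmp_closed rng_cmp)
  then have "n - m = dgr \<Lambda> \<beta>" "dgr \<Lambda> a - n = dgr \<Lambda> \<gamma>"
    by (auto simp: m n)
  then have "\<beta> \<in> Mor_deg \<Lambda> (n - m)" "\<alpha> \<in> Mor_deg \<Lambda> m" "\<gamma> \<in> Mor_deg \<Lambda> (dgr \<Lambda> a - n)"
    using mor by (auto simp: Mor_deg_def m)
  with comp a show "\<beta> \<in> Mor_deg \<Lambda> (n - m) \<and> (\<exists>\<alpha>\<in>Mor_deg \<Lambda> m. \<exists>\<gamma>\<in>Mor_deg \<Lambda> (dgr \<Lambda> a - n).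
        src \<Lambda> \<alpha> = rng \<Lambda> \<beta> \<and> src \<Lambda> \<beta> = rng \<Lambda> \<gamma> \<and> a = cmp \<Lambda> \<alpha> (cmp \<Lambda> \<beta> \<gamma>))"
    by blast
next
  fix \<beta>' assume "\<beta>' \<in> Mor_deg \<Lambda> (n - m) \<and> (\<exists>\<alpha>\<in>Mor_deg \<Lambda> m. \<exists>\<gamma>\<in>Mor_deg \<Lambda> (dgr \<Lambda> a - n).
        src \<Lambda> \<alpha> = rng \<Lambda> \<beta>' \<and> src \<Lambda> \<beta>' = rng \<Lambda> \<gamma> \<and> a = cmp \<Lambda> \<alpha> (cmp \<Lambda> \<beta>' \<gamma>))"
  then obtain \<alpha>' \<gamma>' where *: "\<alpha>' \<in> Mor \<Lambda>" "dgr \<Lambda> \<alpha>' = m" "\<gamma>' \<in> Mor \<Lambda>" "\<beta>' \<in> Mor \<Lambda>" "dgr \<Lambda> \<beta>' = n - m"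
    "src \<Lambda> \<alpha>' = rng \<Lambda> \<beta>'" "src \<Lambda> \<beta>' = rng \<Lambda> \<gamma>'" "a = cmp \<Lambda> \<alpha>' (cmp \<Lambda> \<beta>' \<gamma>')"
    by (auto simp: Mor_deg_def)
  have "cmp \<Lambda> \<beta> \<gamma> = cmp \<Lambda> \<beta>' \<gamma>'"
    by (rule factor_unique(2) [OF _ _ _ _ _ _ _ trans [OF a [symmetric] *(8)]])
      (use mor comp *(1-7) m in \<open>simp_all add: cmp_closed rng_cmp\<close>)
  moreover have "dgr \<Lambda> \<beta> = dgr \<Lambda> \<beta>'" using * by (auto simp: m n)
  ultimately show "\<beta>' = \<beta>"
    using mor comp * by (intro factor_unique(1) [of \<beta>' \<gamma>' \<beta> \<gamma>]) auto
qed

text \<open>A fourfold factorisation \<open>a = \<alpha>\<beta>\<gamma>\<delta>\<close> at the degrees \<open>m \<le> n \<le> p\<close> exhibits the three segments as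
  \<open>\<beta>\<close>, \<open>\<gamma>\<close> and \<open>\<beta>\<gamma>\<close>. This is functoriality of the cube of a path.\<close>

lemma segment_cmp:
  assumes a: "a \<in> Mor \<Lambda>" and le: "m \<le> n" "n \<le> p" "p \<le> dgr \<Lambda> a"
  shows "src \<Lambda> (segment \<Lambda> a m n) = rng \<Lambda> (segment \<Lambda> a n p)"
    and "cmp \<Lambda> (segment \<Lambda> a m n) (segment \<Lambda> a n p) = segment \<Lambda> a m p"
    and "segment \<Lambda> a m n \<in> Mor \<Lambda>" "dgr \<Lambda> (segment \<Lambda> a m n) = n - m"
proof -
  have "m \<le> dgr \<Lambda> a" using le by auto
  then obtain \<alpha> \<mu> where \<mu>: "\<alpha> \<in> Mor \<Lambda>" "\<mu> \<in> Mor \<Lambda>" "src \<Lambda> \<alpha> = rng \<Lambda> \<mu>"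
    "dgr \<Lambda> \<alpha> = m" "dgr \<Lambda> \<mu> = dgr \<Lambda> a - m" "a = cmp \<Lambda> \<alpha> \<mu>"
    by (rule factor_exists [OF a])
  have "n - m \<le> dgr \<Lambda> \<mu>"
  proof (rule le_funI)
    fix x show "(n - m) x \<le> dgr \<Lambda> \<mu> x"
      using le_funD [OF le(2), of x] le_funD [OF le(3), of x] unfolding \<mu>(5) by simp
  qed
  then obtain \<beta> \<nu> where \<nu>: "\<beta> \<in> Mor \<Lambda>" "\<nu> \<in> Mor \<Lambda>" "src \<Lambda> \<beta> = rng \<Lambda> \<nu>"
    "dgr \<Lambda> \<beta> = n - m" "dgr \<Lambda> \<nu> = dgr \<Lambda> \<mu> - (n - m)" "\<mu> = cmp \<Lambda> \<beta> \<nu>"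
    by (rule factor_exists [OF \<mu>(2)])
  have "p - n \<le> dgr \<Lambda> \<nu>"
  proof (rule le_funI)
    fix x show "(p - n) x \<le> dgr \<Lambda> \<nu> x"
      using le_funD [OF le(1), of x] le_funD [OF le(3), of x] unfolding \<nu>(5) \<mu>(5) by simp
  qed
  then obtain \<gamma> \<delta> where \<gamma>: "\<gamma> \<in> Mor \<Lambda>" "\<delta> \<in> Mor \<Lambda>" "src \<Lambda> \<gamma> = rng \<Lambda> \<delta>"
    "dgr \<Lambda> \<gamma> = p - n" "\<nu> = cmp \<Lambda> \<gamma> \<delta>"
    by (rule factor_exists [OF \<nu>(2)])
  have comp: "src \<Lambda> \<alpha> = rng \<Lambda> \<beta>" "src \<Lambda> \<beta> = rng \<Lambda> \<gamma>"
    using \<mu> \<nu> \<gamma> by (simp_all add: rng_cmp cmp_closed)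
  have sum: "m + (n - m) = n" "n + (p - n) = p" "m + ((n - m) + (p - n)) = p"
    using le by (simp_all only: add_diff_deg add.assoc [symmetric])
  have 1: "segment \<Lambda> a m n = \<beta>"
    by (rule segment_eqI [of \<alpha> \<beta> \<nu>]) (use \<mu> \<nu> \<gamma> comp sum in auto)
  have 2: "segment \<Lambda> a n p = \<gamma>"
    by (rule segment_eqI [of "cmp \<Lambda> \<alpha> \<beta>" \<gamma> \<delta>])
      (use \<mu> \<nu> \<gamma> comp sum in \<open>auto simp: cmp_closed src_cmp rng_cmp dgr_cmp cmp_assoc\<close>)
  have 3: "segment \<Lambda> a m p = cmp \<Lambda> \<beta> \<gamma>"
    by (rule segment_eqI [of \<alpha> "cmp \<Lambda> \<beta> \<gamma>" \<delta>])
      (use \<mu> \<nu> \<gamma> comp sum in \<open>auto simp: cmp_closed src_cmp rng_cmp dgr_cmp cmp_assoc\<close>)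
  show "src \<Lambda> (segment \<Lambda> a m n) = rng \<Lambda> (segment \<Lambda> a n p)"
    "cmp \<Lambda> (segment \<Lambda> a m n) (segment \<Lambda> a n p) = segment \<Lambda> a m p"
    "segment \<Lambda> a m n \<in> Mor \<Lambda>" "dgr \<Lambda> (segment \<Lambda> a m n) = n - m"
    unfolding 1 2 3 using comp \<nu> by simp_all
qed

text \<open>A segment \<open>a(m, m)\<close> has degree zero, hence is an identity; composability of \<open>a(m, m)\<close> with
  \<open>a(m, n)\<close> therefore says that it is the range.\<close>

lemma segment_rng_src:
  assumes a: "a \<in> Mor \<Lambda>" and le: "m \<le> n" "n \<le> dgr \<Lambda> a"
  shows "rng \<Lambda> (segment \<Lambda> a m n) = segment \<Lambda> a m m"
    and "src \<Lambda> (segment \<Lambda> a m n) = segment \<Lambda> a n n"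
proof -
  have "dgr \<Lambda> (segment \<Lambda> a m m) = 0" "dgr \<Lambda> (segment \<Lambda> a n n) = 0"
    using segment_cmp(4) [OF a, of m m n] segment_cmp(4) [OF a, of n n n] le by (auto simp: fun_eq_iff)
  moreover have "segment \<Lambda> a m m \<in> Mor \<Lambda>" "segment \<Lambda> a n n \<in> Mor \<Lambda>"
    using segment_cmp(3) [OF a, of m m n] segment_cmp(3) [OF a, of n n n] le by auto
  ultimately show "rng \<Lambda> (segment \<Lambda> a m n) = segment \<Lambda> a m m"
    "src \<Lambda> (segment \<Lambda> a m n) = segment \<Lambda> a n n"
    using segment_cmp(1) [OF a, of m m n] segment_cmp(1) [OF a, of m n n] le
    by (auto simp: degree_zero_identity)
qed

lemma segment_whole:
  assumes a: "a \<in> Mor \<Lambda>" shows "segment \<Lambda> a 0 (dgr \<Lambda> a) = a"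
  by (rule segment_eqI [of "rng \<Lambda> a" a "src \<Lambda> a"])
    (use a in \<open>auto simp: rng_closed src_closed src_rng rng_src src_right_unit rng_left_unit dgr_rng\<close>)

end

section \<open>Nondegenerate cubes are paths\<close>

lemma std_cube_simps [simp]:
  "(p, q) \<in> Mor (std_cube r) \<longleftrightarrow> p \<le> q \<and> q \<le> ones r"
  "rng (std_cube r) (p, q) = (p, p)" "src (std_cube r) (p, q) = (q, q)"
  "cmp (std_cube r) (p, q) (q', u) = (p, u)" "dgr (std_cube r) (p, q) = q - p"
  using le_Nk [OF _ ones_in_Nk] by (auto simp: std_cube_def intro: order_trans)

lemma zero_le_deg: "(0 :: nat \<Rightarrow> nat) \<le> n"
  by (simp add: le_fun_def)

text \<open>The homomorphism in the definition of a cube may be taken to be a relabelling, and it serves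
  at the same time as the witness for the quasimorphism.\<close>

lemma nondeg_cubes_iff:
  "\<phi> \<in> nondeg_cubes k \<Lambda> r \<longleftrightarrow>
    \<phi> \<in> extensional (Mor (std_cube r)) \<and> is_functor (std_cube r) \<Lambda> \<phi> \<and>
    (\<exists>j. strict_mono_on {1..r} j \<and> j ` {1..r} \<subseteq> {1..k} \<and>
      (\<forall>x\<in>Mor (std_cube r). dgr \<Lambda> (\<phi> x) = relabel j r (dgr (std_cube r) x)))"
    (is "?L \<longleftrightarrow> ?R")
proof
  assume ?L
  then obtain h where \<phi>: "\<phi> \<in> extensional (Mor (std_cube r))" "is_functor (std_cube r) \<Lambda> \<phi>"
    and adm: "admissible r k r h" and deg: "\<forall>x\<in>Mor (std_cube r). dgr \<Lambda> (\<phi> x) = h (dgr (std_cube r) x)"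
    by (auto simp: nondeg_cubes_def cubes_def quasimorphism_def)
  from adm obtain i j where hom: "Nk_hom r k h"
    and i: "strict_mono_on {1..r} i" "i ` {1..r} \<subseteq> {1..r}"
    and j: "strict_mono_on {1..r} j" "j ` {1..r} \<subseteq> {1..k}"
    and h: "\<forall>p\<in>{1..r}. h (unit_deg (i p)) = unit_deg (j p)"
    by (auto simp: admissible_def)
  have unit: "h (unit_deg p) = unit_deg (j p)" if "p \<in> {1..r}" for p
    using h strict_mono_self_map [OF i that] that by force
  have "dgr \<Lambda> (\<phi> x) = relabel j r (dgr (std_cube r) x)" if x: "x \<in> Mor (std_cube r)" for x
  proof -
    obtain p q where pq: "x = (p, q)" by fastforce
    have "q - p \<le> q" by (simp add: le_fun_def)
    then have "dgr (std_cube r) x \<in> Nk r"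
      using x le_Nk [OF _ ones_in_Nk] order_trans by (fastforce simp: pq)
    with deg x Nk_hom_eq_relabel [OF hom unit] show ?thesis by simp
  qed
  with \<phi> j show ?R by blast
next
  assume ?R
  then obtain j where \<phi>: "\<phi> \<in> extensional (Mor (std_cube r))" "is_functor (std_cube r) \<Lambda> \<phi>"
    and j: "strict_mono_on {1..r} j" "j ` {1..r} \<subseteq> {1..k}"
    and deg: "\<forall>x\<in>Mor (std_cube r). dgr \<Lambda> (\<phi> x) = relabel j r (dgr (std_cube r) x)"
    by blast
  have hom: "Nk_hom r k (relabel j r)" by (rule Nk_hom_relabel [OF j(2)])
  moreover have "admissible r k r (relabel j r)"
    unfolding admissible_def
    using hom j by (intro conjI exI [of _ "\<lambda>p. p"] exI [of _ j]) (auto simp: relabel_unit_deg strict_mono_on_def)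
  ultimately show ?L
    using \<phi> deg unfolding nondeg_cubes_def cubes_def quasimorphism_def by fastforce
qed

text \<open>The explicit form of \<open>\<phi>\<^sub>a\<close>; it is undefined off the cells of the standard cube, as
  extensionality demands.\<close>

definition path_cube :: "'a deg_category \<Rightarrow> nat \<Rightarrow> 'a \<Rightarrow> cell \<Rightarrow> 'a" where
  "path_cube \<Lambda> r a = restrict (\<lambda>(m, n). segment \<Lambda> a (relabel (direction (dgr \<Lambda> a)) r m)
     (relabel (direction (dgr \<Lambda> a)) r n)) (Mor (std_cube r))"

context k_graph
begin

lemma nondeg_cube_is_path_cube:
  assumes "\<phi> \<in> nondeg_cubes k \<Lambda> r"
  shows "\<phi> (0, ones r) \<in> graph_cubes k \<Lambda> r" "\<phi> = path_cube \<Lambda> r (\<phi> (0, ones r))"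
proof -
  from assms obtain j where ext: "\<phi> \<in> extensional (Mor (std_cube r))" and fn: "is_functor (std_cube r) \<Lambda> \<phi>"
    and j: "strict_mono_on {1..r} j" "j ` {1..r} \<subseteq> {1..k}"
    and deg: "\<And>p q. p \<le> q \<Longrightarrow> q \<le> ones r \<Longrightarrow> dgr \<Lambda> (\<phi> (p, q)) = relabel j r (q - p)"
    by (force simp: nondeg_cubes_iff)
  have mor: "\<phi> (p, q) \<in> Mor \<Lambda>" if "p \<le> q" "q \<le> ones r" for p q
    using fn that unfolding is_functor_def by (auto elim!: funcset_mem)
  have rng: "rng \<Lambda> (\<phi> (p, q)) = \<phi> (p, p)" and src: "src \<Lambda> (\<phi> (p, q)) = \<phi> (q, q)"
    if "p \<le> q" "q \<le> ones r" for p q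
  proof -
    have "(p, q) \<in> Mor (std_cube r)" using that by simp
    then have "\<phi> (rng (std_cube r) (p, q)) = rng \<Lambda> (\<phi> (p, q))"
      "\<phi> (src (std_cube r) (p, q)) = src \<Lambda> (\<phi> (p, q))"
      using fn by (simp_all only: is_functor_def)
    then show "rng \<Lambda> (\<phi> (p, q)) = \<phi> (p, p)" "src \<Lambda> (\<phi> (p, q)) = \<phi> (q, q)" by simp_all
  qed
  have comp: "cmp \<Lambda> (\<phi> (p, q)) (\<phi> (q, u)) = \<phi> (p, u)" if "p \<le> q" "q \<le> u" "u \<le> ones r" for p q u
  proof -
    have "(p, q) \<in> Mor (std_cube r)" "(q, u) \<in> Mor (std_cube r)" using that by auto
    moreover have "src (std_cube r) (p, q) = rng (std_cube r) (q, u)" by simp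
    ultimately have "\<phi> (cmp (std_cube r) (p, q) (q, u)) = cmp \<Lambda> (\<phi> (p, q)) (\<phi> (q, u))"
      using fn unfolding is_functor_def by blast
    then show ?thesis by simp
  qed
  let ?a = "\<phi> (0, ones r)"
  have a: "?a \<in> Mor \<Lambda>" "dgr \<Lambda> ?a = relabel j r (ones r)"
    using mor deg [of 0 "ones r"] by (auto simp: zero_le_deg)
  with relabel_ones_cube [OF j] show "?a \<in> graph_cubes k \<Lambda> r"
    by (simp add: graph_cubes_def)
  have dir: "relabel (direction (dgr \<Lambda> ?a)) r = relabel j r"
    using j(1) by (intro relabel_cong) (simp add: a direction_relabel)
  show "\<phi> = path_cube \<Lambda> r ?a"
  proof (rule extensionalityI [OF ext])
    fix x assume x: "x \<in> Mor (std_cube r)"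
    then obtain m n where mn: "x = (m, n)" and le: "m \<le> n" "n \<le> ones r" by (cases x) auto
    then have m: "m \<le> ones r" by auto
    have "segment \<Lambda> ?a (relabel j r m) (relabel j r n) = \<phi> (m, n)"
    proof (rule segment_eqI [of "\<phi> (0, m)" _ "\<phi> (n, ones r)"])
      show "?a = cmp \<Lambda> (\<phi> (0, m)) (cmp \<Lambda> (\<phi> (m, n)) (\<phi> (n, ones r)))"
        using le m by (simp add: comp zero_le_deg)
      show "relabel j r n = dgr \<Lambda> (\<phi> (0, m)) + dgr \<Lambda> (\<phi> (m, n))"
        using le m by (simp add: deg zero_le_deg add_diff_deg flip: relabel_add)
    qed (use le m in \<open>auto simp: mor rng src deg zero_le_deg\<close>)
    with x show "\<phi> x = path_cube \<Lambda> r ?a x" by (simp add: mn path_cube_def dir)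
  qed (simp add: path_cube_def)
qed

lemma path_cube_nondeg:
  assumes "a \<in> graph_cubes k \<Lambda> r"
  shows "path_cube \<Lambda> r a \<in> nondeg_cubes k \<Lambda> r" "path_cube \<Lambda> r a (0, ones r) = a"
proof -
  let ?h = "relabel (direction (dgr \<Lambda> a)) r"
  have a: "a \<in> Mor \<Lambda>" using assms by (simp add: graph_cubes_def)
  have dir: "strict_mono_on {1..r} (direction (dgr \<Lambda> a))" "direction (dgr \<Lambda> a) ` {1..r} \<subseteq> {1..k}"
    "?h (ones r) = dgr \<Lambda> a"
    using assms relabel_direction by (auto simp: graph_cubes_def)
  have le: "?h n \<le> dgr \<Lambda> a" if "n \<le> ones r" for n
    using relabel_mono [OF that] dir(3) by metis
  have val: "path_cube \<Lambda> r a (m, n) = segment \<Lambda> a (?h m) (?h n)" if "m \<le> n" "n \<le> ones r" for m n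
    using that by (simp add: path_cube_def)
  have "is_functor (std_cube r) \<Lambda> (path_cube \<Lambda> r a)"
    unfolding is_functor_def
  proof (intro conjI funcsetI ballI impI)
    fix x assume "x \<in> Mor (std_cube r)"
    then obtain m n where mn: "x = (m, n)" "m \<le> n" "n \<le> ones r" by (cases x) auto
    then have "m \<le> ones r" by auto
    note h = relabel_mono [OF mn(2)] le [OF mn(3)] this
    show "path_cube \<Lambda> r a x \<in> Mor \<Lambda>"
      using mn h segment_cmp(3) [OF a _ order_refl] by (simp add: val)
    show "path_cube \<Lambda> r a (rng (std_cube r) x) = rng \<Lambda> (path_cube \<Lambda> r a x)"
      "path_cube \<Lambda> r a (src (std_cube r) x) = src \<Lambda> (path_cube \<Lambda> r a x)"
      using mn h segment_rng_src [OF a] by (simp_all add: val)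
  next
    fix x y assume "x \<in> Mor (std_cube r)" "y \<in> Mor (std_cube r)" "src (std_cube r) x = rng (std_cube r) y"
    then obtain m n u where mn: "x = (m, n)" "y = (n, u)" "m \<le> n" "n \<le> u" "u \<le> ones r"
      by (cases x; cases y) auto
    then have "n \<le> ones r" "m \<le> u" by auto
    with mn show "path_cube \<Lambda> r a (cmp (std_cube r) x y) = cmp \<Lambda> (path_cube \<Lambda> r a x) (path_cube \<Lambda> r a y)"
      using segment_cmp(2) [OF a relabel_mono relabel_mono le] by (simp add: val)
  qed
  moreover have "dgr \<Lambda> (path_cube \<Lambda> r a x) = ?h (dgr (std_cube r) x)" if "x \<in> Mor (std_cube r)" for x
  proof -
    from that obtain m n where mn: "x = (m, n)" "m \<le> n" "n \<le> ones r" by (cases x) auto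
    with segment_cmp(4) [OF a relabel_mono [OF mn(2)] order_refl le [OF mn(3)]]
    show ?thesis by (simp add: val relabel_diff)
  qed
  ultimately show "path_cube \<Lambda> r a \<in> nondeg_cubes k \<Lambda> r"
    unfolding nondeg_cubes_iff using dir by (intro conjI exI [of _ "direction (dgr \<Lambda> a)"]) (auto simp: path_cube_def)
  show "path_cube \<Lambda> r a (0, ones r) = a"
    using segment_whole [OF a] by (simp add: val zero_le_deg dir)
qed

lemma cube_of_eq_path_cube:
  assumes "a \<in> graph_cubes k \<Lambda> r" shows "cube_of k \<Lambda> r a = path_cube \<Lambda> r a"
  unfolding cube_of_def
  using path_cube_nondeg [OF assms] nondeg_cube_is_path_cube(2) by (intro the_equality) auto

lemma bij_betw_cube_of: "bij_betw (cube_of k \<Lambda> r) (graph_cubes k \<Lambda> r) (nondeg_cubes k \<Lambda> r)"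
  by (rule bij_betw_byWitness [where f' = "\<lambda>\<phi>. \<phi> (0, ones r)"])
    (auto simp: cube_of_eq_path_cube path_cube_nondeg nondeg_cube_is_path_cube(1)
      simp flip: nondeg_cube_is_path_cube(2))

end

section \<open>Faces\<close>

lemma eps_simps [simp]: "eps l i (p, q) = (ins i l p, ins i l q)"
  by (simp add: eps_def)

lemma cube_face_apply:
  "m \<le> n \<Longrightarrow> n \<le> ones r \<Longrightarrow> cube_face (Suc r) l i \<phi> (m, n) = \<phi> (ins i l m, ins i l n)"
  by (simp add: cube_face_def)

lemma eps_in_Mor:
  "i \<in> {1..Suc r} \<Longrightarrow> l \<le> 1 \<Longrightarrow> x \<in> Mor (std_cube r) \<Longrightarrow> eps l i x \<in> Mor (std_cube (Suc r))"
  by (cases x) (simp add: ins_le_iff ins_le_ones)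

text \<open>On degrees, inserting \<open>l\<close> in both entries of a cell inserts \<open>0\<close>, so if the cube relabels along
  \<open>j\<close>, then its face relabels along \<open>j\<close> with the \<open>i\<close>th value left out.\<close>

lemma cube_face_nondeg:
  assumes \<phi>: "\<phi> \<in> nondeg_cubes k \<Lambda> (Suc r)" and i: "i \<in> {1..Suc r}" and l: "l \<le> 1"
  shows "cube_face (Suc r) l i \<phi> \<in> nondeg_cubes k \<Lambda> r"
proof -
  from \<phi> obtain j where fn: "is_functor (std_cube (Suc r)) \<Lambda> \<phi>"
    and j: "strict_mono_on {1..Suc r} j" "j ` {1..Suc r} \<subseteq> {1..k}"
    and deg: "\<And>x. x \<in> Mor (std_cube (Suc r)) \<Longrightarrow>
      dgr \<Lambda> (\<phi> x) = relabel j (Suc r) (dgr (std_cube (Suc r)) x)"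
    by (force simp: nondeg_cubes_iff)
  let ?\<psi> = "cube_face (Suc r) l i \<phi>"
  note eps = eps_in_Mor [OF i l]
  have val: "?\<psi> x = \<phi> (eps l i x)" if "x \<in> Mor (std_cube r)" for x
    using that by (simp add: cube_face_def)
  have "is_functor (std_cube r) \<Lambda> ?\<psi>"
    unfolding is_functor_def
  proof (intro conjI funcsetI ballI impI)
    fix x assume x: "x \<in> Mor (std_cube r)"
    show "?\<psi> x \<in> Mor \<Lambda>"
      using fn eps [OF x] x by (auto simp: val is_functor_def)
    obtain p q where pq: "x = (p, q)" by fastforce
    with x have "(p, p) \<in> Mor (std_cube r)" "(q, q) \<in> Mor (std_cube r)" by auto
    moreover have "\<phi> (rng (std_cube (Suc r)) (eps l i x)) = rng \<Lambda> (\<phi> (eps l i x))"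
      "\<phi> (src (std_cube (Suc r)) (eps l i x)) = src \<Lambda> (\<phi> (eps l i x))"
      using fn eps [OF x] by (auto simp only: is_functor_def)
    ultimately show "?\<psi> (rng (std_cube r) x) = rng \<Lambda> (?\<psi> x)" "?\<psi> (src (std_cube r) x) = src \<Lambda> (?\<psi> x)"
      using x by (simp_all add: val pq del: std_cube_simps(1))
  next
    fix x y assume x: "x \<in> Mor (std_cube r)" and y: "y \<in> Mor (std_cube r)"
      and comp: "src (std_cube r) x = rng (std_cube r) y"
    then obtain p q u where pq: "x = (p, q)" "y = (q, u)" by (cases x; cases y) auto
    with x y have "(p, u) \<in> Mor (std_cube r)" by auto
    moreover have "\<phi> (cmp (std_cube (Suc r)) (eps l i x) (eps l i y)) = cmp \<Lambda> (\<phi> (eps l i x)) (\<phi> (eps l i y))"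
    proof -
      have "src (std_cube (Suc r)) (eps l i x) = rng (std_cube (Suc r)) (eps l i y)" by (simp add: pq)
      with fn eps [OF x] eps [OF y] show ?thesis unfolding is_functor_def by blast
    qed
    ultimately show "?\<psi> (cmp (std_cube r) x y) = cmp \<Lambda> (?\<psi> x) (?\<psi> y)"
      using x y by (simp add: val pq del: std_cube_simps(1))
  qed
  moreover have "dgr \<Lambda> (?\<psi> x) = relabel (j \<circ> skip i) r (dgr (std_cube r) x)"
    if x: "x \<in> Mor (std_cube r)" for x
    using deg [OF eps [OF x]] x relabel_ins [OF i, of j 0]
    by (cases x) (simp add: val ins_diff zero_fun_def [symmetric] del: std_cube_simps(1))
  moreover have "strict_mono_on {1..r} (j \<circ> skip i)" "(j \<circ> skip i) ` {1..r} \<subseteq> {1..k}"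
  proof -
    have im: "skip i ` {1..r} \<subseteq> {1..Suc r}" using skip_image [OF i] by blast
    show "strict_mono_on {1..r} (j \<circ> skip i)"
    proof (rule strict_mono_onI)
      fix p q assume "p \<in> {1..r}" "q \<in> {1..r}" "p < q"
      with im strict_monoD [OF strict_mono_skip, of p q i] show "(j \<circ> skip i) p < (j \<circ> skip i) q"
        unfolding comp_def by (intro strict_mono_onD [OF j(1)]) blast+
    qed
    show "(j \<circ> skip i) ` {1..r} \<subseteq> {1..k}"
      using im j(2) by (auto simp: image_subset_iff)
  qed
  ultimately show ?thesis
    unfolding nondeg_cubes_iff by (intro conjI exI [of _ "j \<circ> skip i"]) (auto simp: cube_face_def)
qed

lemma ins_ones: "i \<in> {1..Suc r} \<Longrightarrow> ins i 1 (ones r) = ones (Suc r)"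
  by (rule ext) (auto simp: ins_def ones_apply)

text \<open>Both claims follow from the value of the face of the cube at its top cell: that value is the
  segment of \<open>a\<close> between the images of the two corners of the face, which is \<open>F\<^sub>i\<^sup>l(a)\<close>, and a
  nondegenerate cube is the cube of the path at its top cell.\<close>

lemma (in k_graph) path_cube_face:
  assumes a: "a \<in> graph_cubes k \<Lambda> (Suc r)" and i: "i \<in> {1..Suc r}" and l: "l \<le> 1"
  shows "graph_face \<Lambda> l i a \<in> graph_cubes k \<Lambda> r"
    and "path_cube \<Lambda> r (graph_face \<Lambda> l i a) = cube_face (Suc r) l i (path_cube \<Lambda> (Suc r) a)"
proof -
  let ?d = "dgr \<Lambda> a" and ?\<phi> = "cube_face (Suc r) l i (path_cube \<Lambda> (Suc r) a)"
  let ?u = "unit_deg (direction ?d i)"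
  have dir: "relabel (direction ?d) (Suc r) (ones (Suc r)) = ?d"
    using a relabel_direction(3) by (auto simp: graph_cubes_def)
  have zero: "relabel (direction ?d) (Suc r) (ins i l 0) = (if l = 0 then 0 else ?u)"
    using l by (auto simp: relabel_ins [OF i] fun_eq_iff)
  have top: "relabel (direction ?d) (Suc r) (ins i 0 (ones r)) + ?u = ?d"
  proof -
    have "relabel (direction ?d) (Suc r) (ins i 0 (ones r)) + ?u = relabel (direction ?d) (Suc r) (ins i 1 (ones r))"
      by (simp add: relabel_ins [OF i] fun_eq_iff)
    with dir show ?thesis by (simp only: ins_ones [OF i])
  qed
  have one: "relabel (direction ?d) (Suc r) (ins i l (ones r)) = (if l = 0 then ?d - ?u else ?d)"
  proof (cases "l = 0")
    case True
    have "relabel (direction ?d) (Suc r) (ins i 0 (ones r)) =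
        relabel (direction ?d) (Suc r) (ins i 0 (ones r)) + ?u - ?u"
      by (rule ext) simp
    with True show ?thesis by (simp only: top simp_thms if_True)
  next
    case False
    with l have "l = 1" by simp
    with dir ins_ones [OF i] show ?thesis by simp
  qed
  have "?\<phi> (0, ones r) = path_cube \<Lambda> (Suc r) a (ins i l 0, ins i l (ones r))"
    by (simp add: cube_face_apply zero_le_deg)
  also have "\<dots> = graph_face \<Lambda> l i a"
    using i l by (simp add: path_cube_def ins_le_iff ins_le_ones zero_le_deg zero one graph_face_def)
  finally have eq: "?\<phi> (0, ones r) = graph_face \<Lambda> l i a" .
  from nondeg_cube_is_path_cube [OF cube_face_nondeg [OF path_cube_nondeg(1) [OF a] i l]]
  show "graph_face \<Lambda> l i a \<in> graph_cubes k \<Lambda> r" "path_cube \<Lambda> r (graph_face \<Lambda> l i a) = ?\<phi>"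
    unfolding eq by simp_all
qed

section \<open>Cubical boundaries and homology\<close>

lemma frag_extend_hom:
  "(\<And>x. x \<in> S \<Longrightarrow> Poly_Mapping.keys (g x) \<subseteq> T) \<Longrightarrow>
    frag_extend g \<in> hom (free_Abelian_group S) (free_Abelian_group T)"
  using keys_frag_extend [of g] by (fastforce simp: hom_def frag_extend_add)

lemma iso_frag_extend:
  assumes f: "bij_betw f S T"
  shows "frag_extend (\<lambda>a. frag_of (f a)) \<in> iso (free_Abelian_group S) (free_Abelian_group T)"
proof -
  have inverse: "frag_extend (frag_of \<circ> v) (frag_extend (frag_of \<circ> u) c) = c"
    if "\<And>x. x \<in> A \<Longrightarrow> v (u x) = x" "Poly_Mapping.keys c \<subseteq> A"
    for A :: "'c set" and u :: "'c \<Rightarrow> 'd" and v c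
  proof -
    have "frag_extend (frag_of \<circ> v) (frag_extend (frag_of \<circ> u) c) = frag_extend frag_of c"
      unfolding frag_extend_compose using that by (intro frag_extend_eq) auto
    then show ?thesis by (simp flip: frag_expansion)
  qed
  let ?g = "the_inv_into S f"
  have hom: "frag_extend (frag_of \<circ> f) \<in> hom (free_Abelian_group S) (free_Abelian_group T)"
    "frag_extend (frag_of \<circ> ?g) \<in> hom (free_Abelian_group T) (free_Abelian_group S)"
    using f bij_betw_the_inv_into [OF f] by (auto intro!: frag_extend_hom dest: bij_betwE)
  have "bij_betw (frag_extend (frag_of \<circ> f)) (carrier (free_Abelian_group S)) (carrier (free_Abelian_group T))"
  proof (rule bij_betw_byWitness [where f' = "frag_extend (frag_of \<circ> ?g)"])
    show "\<forall>c\<in>carrier (free_Abelian_group S). frag_extend (frag_of \<circ> ?g) (frag_extend (frag_of \<circ> f) c) = c"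
      using f by (auto intro!: inverse [of S] simp: the_inv_into_f_f bij_betw_def)
    show "\<forall>c\<in>carrier (free_Abelian_group T). frag_extend (frag_of \<circ> f) (frag_extend (frag_of \<circ> ?g) c) = c"
      using f by (auto intro!: inverse [of T] simp: f_the_inv_into_f bij_betw_def)
  qed (use hom in \<open>auto simp: hom_def\<close>)
  with hom(1) show ?thesis by (simp add: iso_def comp_def)
qed

text \<open>The common form of both boundary maps, which lets one argument treat the alternating sum over
  faces.\<close>

definition cubical_boundary ::
  "(nat \<Rightarrow> nat \<Rightarrow> 'c \<Rightarrow> 'd) \<Rightarrow> nat \<Rightarrow> ('c \<Rightarrow>\<^sub>0 int) \<Rightarrow> ('d \<Rightarrow>\<^sub>0 int)" where
  "cubical_boundary d r = frag_extend
     (\<lambda>x. \<Sum>(l, i)\<in>{0..1} \<times> {1..r}. frag_cmul ((-1) ^ (i + l)) (frag_of (d l i x)))"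

lemma graph_boundary_cubical: "graph_boundary \<Lambda> r = cubical_boundary (graph_face \<Lambda>) r"
  by (simp add: graph_boundary_def cubical_boundary_def sum.cartesian_product)

lemma cube_boundary_cubical: "cube_boundary r = cubical_boundary (cube_face r) r"
  by (simp add: cube_boundary_def cubical_boundary_def sum.cartesian_product)

lemma cubical_boundary_hom:
  assumes "\<And>l i x. x \<in> S \<Longrightarrow> l \<le> 1 \<Longrightarrow> i \<in> {1..r} \<Longrightarrow> d l i x \<in> T"
  shows "cubical_boundary d r \<in> hom (free_Abelian_group S) (free_Abelian_group T)"
  unfolding cubical_boundary_def
proof (rule frag_extend_hom)
  fix x assume "x \<in> S"
  then show "Poly_Mapping.keys (\<Sum>(l, i)\<in>{0..1} \<times> {1..r}. frag_cmul ((-1) ^ (i + l)) (frag_of (d l i x))) \<subseteq> T"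
    using assms by (intro order_trans [OF keys_sum]) auto
qed

lemma cubical_boundary_0 [simp]: "cubical_boundary d 0 c = 0"
  by (simp add: cubical_boundary_def frag_extend_eq_0)

text \<open>The double faces with \<open>i < j\<close> (the face \<open>j\<close> taken first) are paired with those in which the
  second face has index at least that of the first: by the cubical identity the partner of
  \<open>(m, j), (l, i)\<close> is \<open>(l, i), (m, j - 1)\<close>, and the shift of one index reverses the sign.\<close>

lemma cubical_boundary_square:
  assumes d: "\<And>l m i j x. l \<le> 1 \<Longrightarrow> m \<le> 1 \<Longrightarrow> 1 \<le> i \<Longrightarrow> i < j \<Longrightarrow> j \<le> Suc r \<Longrightarrow>
      x \<in> S \<Longrightarrow> d l i (d' m j x) = d m (j - 1) (d' l i x)"
    and c: "Poly_Mapping.keys c \<subseteq> S"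
  shows "cubical_boundary d r (cubical_boundary d' (Suc r) c) = 0"
  using c
proof (induction c rule: frag_induction)
  case (one x)
  let ?P = "({0..1::nat} \<times> {1..Suc r}) \<times> ({0..1::nat} \<times> {1..r})"
  let ?U = "{((m, j), (l, i)) \<in> ?P. i < j}" and ?V = "{((m, j), (l, i)) \<in> ?P. j \<le> i}"
  define F where "F = (\<lambda>((m, j), (l, i)). frag_cmul ((-1) ^ (j + m) * (-1) ^ (i + l)) (frag_of (d l i (d' m j x))))"
  have "cubical_boundary d r (cubical_boundary d' (Suc r) (frag_of x)) = sum F ?P"
    by (simp add: cubical_boundary_def frag_extend_sum frag_extend_cmul frag_cmul_sum F_def
        sum.cartesian_product case_prod_unfold comp_def)
  also have "?P = ?U \<union> ?V" by force
  also have "sum F (?U \<union> ?V) = sum F ?U + sum F ?V"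
    by (rule sum.union_disjoint) (auto intro: finite_subset [of _ ?P])
  also have "sum F ?U = (\<Sum>p\<in>?V. - F p)"
  proof (rule sum.reindex_bij_witness [where
        i = "\<lambda>((m, j), (l, i)). ((l, Suc i), (m, j))" and j = "\<lambda>((m, j), (l, i)). ((l, i), (m, j - 1))"])
    fix p assume "p \<in> ?U"
    then obtain m j l i where p: "p = ((m, j), (l, i))" "m \<le> 1" "l \<le> 1" "1 \<le> i" "i < j" "j \<le> Suc r"
      by auto
    then obtain j' where j': "j = Suc j'" by (cases j) auto
    show "- F ((\<lambda>((m, j), (l, i)). ((l, i), (m, j - 1))) p) = F p"
      using d [OF p(3,2,4,5,6) one] by (simp add: F_def p(1) j' mult.commute)
  qed auto
  finally show ?case by (simp add: sum_negf)
qed (simp_all add: cubical_boundary_def frag_extend_diff)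

lemma cube_face_cube_face:
  assumes "i \<in> {1..Suc r}" "l \<le> 1" "m \<le> 1" "i < j" "j \<le> Suc (Suc r)"
  shows "cube_face (Suc r) l i (cube_face (Suc (Suc r)) m j \<phi>)
    = cube_face (Suc r) m (j - 1) (cube_face (Suc (Suc r)) l i \<phi>)"
proof (rule extensionalityI [of _ "Mor (std_cube r)"])
  fix x assume x: "x \<in> Mor (std_cube r)"
  have j: "j - 1 \<in> {1..Suc r}" using assms by auto
  show "cube_face (Suc r) l i (cube_face (Suc (Suc r)) m j \<phi>) x
      = cube_face (Suc r) m (j - 1) (cube_face (Suc (Suc r)) l i \<phi>) x"
    using x eps_in_Mor [OF assms(1,2) x] eps_in_Mor [OF j assms(3) x] assms(4)
    by (cases x) (simp add: cube_face_def ins_ins del: std_cube_simps(1))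
qed (auto simp: cube_face_def)

lemma (in comm_group) subgroup_comm_group:
  assumes "subgroup H G" shows "comm_group (G\<lparr>carrier := H\<rparr>)"
  by (rule group.group_comm_groupI [OF subgroup.subgroup_is_group [OF assms is_group]])
    (use subgroup.subset [OF assms] in \<open>auto intro: m_comm\<close>)

text \<open>The first isomorphism theorem for \<open>x \<mapsto> h(N) h(x)\<close>, whose kernel is \<open>N\<close> because \<open>h\<close> is injective.\<close>

lemma Mod_iso_image:
  assumes G: "comm_group G" and H: "comm_group H" and h: "h \<in> iso G H" and N: "subgroup N G"
  shows "G Mod N \<cong> H Mod (h ` N)"
proof -
  interpret G: comm_group G by fact
  interpret H: comm_group H by fact
  have hom: "h \<in> hom G H" and inj: "inj_on h (carrier G)" and im: "h ` carrier G = carrier H"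
    using h by (auto simp: iso_def bij_betw_def)
  interpret h: group_hom G H h by unfold_locales (rule hom)
  have hN: "subgroup (h ` N) H" by (rule h.subgroup_img_is_subgroup [OF N])
  then have normal: "h ` N \<lhd> H" by (rule H.subgroup_imp_normal)
  let ?q = "\<lambda>x. h ` N #>\<^bsub>H\<^esub> h x"
  have q: "group_hom G (H Mod (h ` N)) ?q"
    using hom_compose [OF hom normal.r_coset_hom_Mod [OF normal]] normal.factorgroup_is_group [OF normal]
    by (simp add: group_hom_def group_hom_axioms_def comp_def)
  have "?q ` carrier G = carrier (H Mod (h ` N))"
    by (auto simp: FactGroup_def RCOSETS_def simp flip: im)
  moreover have "kernel G (H Mod (h ` N)) ?q = N"
  proof -
    have "?q x = h ` N \<longleftrightarrow> x \<in> N" if x: "x \<in> carrier G" for x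
    proof -
      have "?q x = h ` N \<longleftrightarrow> h x \<in> h ` N"
        using H.coset_join1 [OF _ h.hom_closed [OF x] hN] H.coset_join2 [OF h.hom_closed [OF x] hN] by (rule iffI)
      also have "\<dots> \<longleftrightarrow> x \<in> N"
        using inj_on_image_mem_iff [OF inj x subgroup.subset [OF N]] .
      finally show ?thesis .
    qed
    then show ?thesis using subgroup.subset [OF N] by (auto simp: kernel_def FactGroup_def)
  qed
  ultimately show ?thesis using group_hom.FactGroup_iso [OF q] by simp
qed

lemma homology_complex_iso:
  assumes "complex_iso C D C' D' f"
  shows "homology C' D' r \<cong> homology C D r"
proof -
  have C: "\<And>r. comm_group (C r)" "\<And>r. D r \<in> hom (C r) (C (r - 1))"
    and DD: "\<And>c. c \<in> carrier (C (Suc r)) \<Longrightarrow> D r (D (Suc r) c) = \<one>\<^bsub>C (r - 1)\<^esub>"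
    and C': "\<And>r. comm_group (C' r)" "\<And>r. D' r \<in> hom (C' r) (C' (r - 1))"
    and f: "\<And>r. f r \<in> iso (C r) (C' r)"
    and comm: "\<And>r c. c \<in> carrier (C r) \<Longrightarrow> f (r - 1) (D r c) = D' r (f r c)"
    using assms by (auto simp: complex_iso_def chain_complex_def)
  have grp: "group (C r)" "group (C' r)" for r
    using C(1) C'(1) by (auto simp: comm_group_def)
  have hom: "group_hom (C r) (C (r - 1)) (D r)" "group_hom (C' r) (C' (r - 1)) (D' r)"
    "group_hom (C r) (C' r) (f r)" for r
    using C C' f grp by (auto simp: group_hom_def group_hom_axioms_def iso_def)
  have bij: "inj_on (f r) (carrier (C r))" "f r ` carrier (C r) = carrier (C' r)" for r
    using f by (auto simp: iso_def bij_betw_def)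
  let ?K = "kernel (C r) (C (r - 1)) (D r)" and ?K' = "kernel (C' r) (C' (r - 1)) (D' r)"
  let ?B = "D (Suc r) ` carrier (C (Suc r))"
  have K: "subgroup ?K (C r)" "subgroup ?K' (C' r)"
    using group_hom.subgroup_kernel [OF hom(1)] group_hom.subgroup_kernel [OF hom(2)] .
  have ker: "f r c \<in> ?K' \<longleftrightarrow> c \<in> ?K" if c: "c \<in> carrier (C r)" for c
  proof -
    have Dc: "D r c \<in> carrier (C (r - 1))" using hom(1) c by (rule group_hom.hom_closed)
    have "f r c \<in> ?K' \<longleftrightarrow> f (r - 1) (D r c) = f (r - 1) \<one>\<^bsub>C (r - 1)\<^esub>"
      using c bij(2) [of r] by (auto simp: kernel_def comm group_hom.hom_one [OF hom(3)])
    also have "\<dots> \<longleftrightarrow> c \<in> ?K"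
      using c Dc inj_on_eq_iff [OF bij(1) Dc group.is_monoid [OF grp(1), THEN monoid.one_closed]]
      by (auto simp: kernel_def)
    finally show ?thesis .
  qed
  have KC: "?K \<subseteq> carrier (C r)" "?K' \<subseteq> carrier (C' r)" by (auto simp: kernel_def)
  have img: "f r ` ?K = ?K'"
  proof
    show "f r ` ?K \<subseteq> ?K'" using ker KC by blast
    show "?K' \<subseteq> f r ` ?K"
    proof
      fix c' assume c': "c' \<in> ?K'"
      with KC bij(2) [of r] obtain c where "c \<in> carrier (C r)" "c' = f r c" by blast
      with c' ker show "c' \<in> f r ` ?K" by blast
    qed
  qed
  let ?G = "(C r)\<lparr>carrier := ?K\<rparr>" and ?H = "(C' r)\<lparr>carrier := ?K'\<rparr>"
  have comm_groups: "comm_group ?G" "comm_group ?H"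
    using K C(1) C'(1) by (auto intro: comm_group.subgroup_comm_group)
  have iso: "f r \<in> iso ?G ?H"
    using f [of r] KC img inj_on_subset [OF bij(1) KC(1)]
    by (auto simp: iso_def hom_def bij_betw_def subsetD [OF KC(1)])
  have "subgroup ?B (C r)"
    using group_hom.img_is_subgroup [OF hom(1) [of "Suc r"]] by simp
  moreover have "?B \<subseteq> ?K"
    using DD group_hom.hom_closed [OF hom(1) [of "Suc r"]] by (auto simp: kernel_def)
  ultimately have B: "subgroup ?B ?G"
    using K(1) by (intro group.subgroup_incl [OF grp(1)])
  have "f r ` ?B = (\<lambda>c. D' (Suc r) (f (Suc r) c)) ` carrier (C (Suc r))"
    using comm [of _ "Suc r"] by (simp add: image_image)
  also have "\<dots> = D' (Suc r) ` carrier (C' (Suc r))"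
    by (simp add: image_image flip: bij(2))
  finally have fB: "f r ` ?B = D' (Suc r) ` carrier (C' (Suc r))" .
  have "homology C D r \<cong> homology C' D' r"
    using Mod_iso_image [OF comm_groups iso B] unfolding homology_def fB .
  moreover have "group (homology C D r)"
    unfolding homology_def using B comm_groups(1)
    by (intro normal.factorgroup_is_group comm_group.subgroup_imp_normal)
  ultimately show ?thesis by (simp add: group.iso_sym)
qed

section \<open>The isomorphism of complexes\<close>

lemma (in k_graph) cube_chain_complex: "chain_complex (cube_chains k \<Lambda>) cube_boundary"
  unfolding chain_complex_def
proof (intro conjI allI ballI)
  fix r
  show "comm_group (cube_chains k \<Lambda> r)"
    by (simp add: cube_chains_def abelian_free_Abelian_group)
  show "cube_boundary r \<in> hom (cube_chains k \<Lambda> r) (cube_chains k \<Lambda> (r - 1))"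
    unfolding cube_boundary_cubical cube_chains_def
    by (cases r) (auto intro!: cubical_boundary_hom cube_face_nondeg)
  fix c assume "c \<in> carrier (cube_chains k \<Lambda> (Suc r))"
  then have c: "Poly_Mapping.keys c \<subseteq> nondeg_cubes k \<Lambda> (Suc r)" by (simp add: cube_chains_def)
  have "cubical_boundary (cube_face r) r (cubical_boundary (cube_face (Suc r)) (Suc r) c) = 0"
  proof (cases r)
    case (Suc s)
    show ?thesis
      unfolding Suc by (rule cubical_boundary_square [OF _ c [unfolded Suc]]) (auto intro!: cube_face_cube_face)
  qed simp
  then show "cube_boundary r (cube_boundary (Suc r) c) = \<one>\<^bsub>cube_chains k \<Lambda> (r - 1)\<^esub>"
    by (simp add: cube_boundary_cubical cube_chains_def)
qed (simp add: cube_boundary_cubical cube_chains_def)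

lemma (in k_graph) cube_of_face:
  assumes "a \<in> graph_cubes k \<Lambda> (Suc r)" "i \<in> {1..Suc r}" "l \<le> 1"
  shows "cube_of k \<Lambda> r (graph_face \<Lambda> l i a) = cube_face (Suc r) l i (cube_of k \<Lambda> (Suc r) a)"
  using path_cube_face [OF assms] assms(1) by (simp add: cube_of_eq_path_cube)

text \<open>That the graph complex is a complex is not checked on its generators: the comparison maps
  are injective and turn \<open>\<partial>\<partial>\<close> of the graph into \<open>\<partial>\<partial>\<close> of the cubes.\<close>

lemma (in k_graph) complex_iso_cube_of:
  "complex_iso (graph_chains k \<Lambda>) (graph_boundary \<Lambda>) (cube_chains k \<Lambda>) cube_boundary
    (\<lambda>r. frag_extend (\<lambda>a. frag_of (cube_of k \<Lambda> r a)))"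
proof -
  let ?f = "\<lambda>r. frag_extend (\<lambda>a. frag_of (cube_of k \<Lambda> r a))"
  let ?C = "graph_chains k \<Lambda>" and ?D = "graph_boundary \<Lambda>"
  have iso: "?f r \<in> iso (?C r) (cube_chains k \<Lambda> r)" for r
    unfolding graph_chains_def cube_chains_def by (rule iso_frag_extend [OF bij_betw_cube_of])
  have comm: "?f (r - 1) (?D r c) = cube_boundary r (?f r c)" if c: "c \<in> carrier (?C r)" for r c
  proof (cases r)
    case 0
    then show ?thesis by (simp add: graph_boundary_cubical cube_boundary_cubical)
  next
    case (Suc s)
    from c have "Poly_Mapping.keys c \<subseteq> graph_cubes k \<Lambda> (Suc s)" by (simp add: graph_chains_def Suc)
    then have "?f s (?D (Suc s) c) = cube_boundary (Suc s) (?f (Suc s) c)"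
    proof (induction c rule: frag_induction)
      case (one a)
      then show ?case
        by (auto simp: graph_boundary_cubical cube_boundary_cubical cubical_boundary_def frag_extend_sum
            frag_extend_cmul cube_of_face intro!: sum.cong)
    qed (simp_all add: graph_boundary_def cube_boundary_def frag_extend_diff)
    then show ?thesis by (simp add: Suc)
  qed
  have hom: "?D r \<in> hom (?C r) (?C (r - 1))" for r
    unfolding graph_boundary_cubical graph_chains_def
    by (cases r) (auto intro!: cubical_boundary_hom path_cube_face)
  have cc: "chain_complex (cube_chains k \<Lambda>) cube_boundary" by (rule cube_chain_complex)
  have "chain_complex ?C ?D"
    unfolding chain_complex_def
  proof (intro conjI allI ballI)
    fix r c assume c: "c \<in> carrier (?C (Suc r))"
    have Dc: "?D (Suc r) c \<in> carrier (?C r)"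
      using hom_in_carrier [OF hom [of "Suc r"] c] by simp
    then have DDc: "?D r (?D (Suc r) c) \<in> carrier (?C (r - 1))"
      by (rule hom_in_carrier [OF hom])
    have "?f (Suc r) c \<in> carrier (cube_chains k \<Lambda> (Suc r))"
      using iso [of "Suc r"] c by (auto simp: iso_def dest: hom_in_carrier)
    then have "?f (r - 1) (?D r (?D (Suc r) c)) = \<one>\<^bsub>cube_chains k \<Lambda> (r - 1)\<^esub>"
      using cc comm [OF Dc] comm [OF c] by (simp add: chain_complex_def)
    then have eq: "?f (r - 1) (?D r (?D (Suc r) c)) = ?f (r - 1) 0"
      by (simp add: cube_chains_def)
    have inj: "inj_on (?f (r - 1)) (carrier (?C (r - 1)))"
      using iso by (auto simp: iso_def bij_betw_def)
    have "?D r (?D (Suc r) c) = 0"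
      by (rule inj_onD [OF inj eq DDc]) (simp add: graph_chains_def)
    then show "?D r (?D (Suc r) c) = \<one>\<^bsub>?C (r - 1)\<^esub>"
      by (simp add: graph_chains_def)
  qed (use hom in \<open>simp_all add: graph_chains_def abelian_free_Abelian_group graph_boundary_cubical\<close>)
  with iso comm cc show ?thesis by (simp add: complex_iso_def)
qed

theorem theoremA9:
  fixes k :: nat and \<Lambda> :: "'a deg_category"
  assumes "k_graph k \<Lambda>"
  shows "(\<forall>r. bij_betw (cube_of k \<Lambda> r) (graph_cubes k \<Lambda> r) (nondeg_cubes k \<Lambda> r)) \<and>
    complex_iso (graph_chains k \<Lambda>) (graph_boundary \<Lambda>) (cube_chains k \<Lambda>) cube_boundary
      (\<lambda>r. frag_extend (\<lambda>a. frag_of (cube_of k \<Lambda> r a))) \<and>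
    (\<forall>r. cube_homology k \<Lambda> r \<cong> graph_homology k \<Lambda> r)"
proof -
  interpret k_graph k \<Lambda> by fact
  show ?thesis
    using bij_betw_cube_of complex_iso_cube_of homology_complex_iso [OF complex_iso_cube_of]
    by (simp add: cube_homology_def graph_homology_def)
qed

end
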